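(* Let $G$ be a discrete distribution on $\{1,2,\dots,m\}$ such that $\mathbb{P}(X=1)<1$ for $X\sim G$. For each $k\in\{1,2,\dots,m\}$, let $\mathcal{F}_k$ be a finite set of good probability distributions with density functions supported on $[0,1]^{k-1}$. Start with a stick of length $L$. At each level $i$, independently choose $k\in\{1,2,\dots,m\}$ according to $G$ (one choice per level, the same $k$ for every stick of that level), and break up every stick into $k$ parts by cutting it at the $k-1$ coordinates of a random variable sampled from some distribution in $\mathcal{F}_k$. Then the distribution of the stick lengths at level $N$ approaches a strong Benford distribution (base $B$) almost surely as $N\to\infty$.
   Context: Fix a base $B>1$. Each $x>0$ is written uniquely as $x=S_B(x)B^{j}$ with $S_B(x)\in[1,B)$ and $j\in\mathbb{Z}$; $S_B(x)$ is the significand of $x$. A sequence of finite collections of positive numbers $\mathcal{A}_n=\{a_{n,i}\}$ (counted with multiplicity) converges to strong Benford behavior (base $B$) if $\lim_{n\to\infty}\#\{i:1\le S_B(a_{n,i})\le s\}/|\mathcal{A}_n|=\log_B s$ for all $s\in[1,B)$. "Almost surely" means that, with probability 1, the realized collections of stick lengths present after $N$ levels converge to strong Benford behavior in this sense as $N\to\infty$. Good distributions: let $\mathcal{D}$ be a probability distribution on $\mathbb{R}^d$ supported on $[0,1]^d$. For $X\sim\mathcal{D}$ let $\mathrm{rk}_i(X)$ be its $i$-th smallest coordinate ($1\le i\le d$), $\mathrm{rk}_0(X)=0$, $\mathrm{rk}_{d+1}(X)=1$. $\mathcal{D}$ is good if $\mathrm{rk}_{i+1}(X)-\mathrm{rk}_i(X)$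 has Hölder continuous density for all $0\le i\le d$. The coordinates are relative cut positions: cutting a stick of length $\ell$ at $X\in[0,1]^{k-1}$ produces $k$ sticks of lengths $\ell(\mathrm{rk}_{i+1}(X)-\mathrm{rk}_i(X))$, $0\le i\le k-1$. Each breaking of a stick uses a newly sampled random variable. When $k=1$ there are no cut points, the stick is left unbroken, and the goodness condition is vacuous. *)

theory Defs
  imports "HOL-Probability.Probability"
begin

definition significand :: "real \<Rightarrow> real \<Rightarrow> real" where
  "significand B x = (THE s. 1 \<le> s \<and> s < B \<and> (\<exists>j::int. x = s * B powi j))"

definition strong_benford_limit :: "real \<Rightarrow> (nat \<Rightarrow> real multiset) \<Rightarrow> bool" where
  "strong_benford_limit B A \<longleftrightarrow>
     (\<forall>n. \<forall>a\<in>#A n. 0 < a) \<and>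
     (\<forall>s\<in>{1..<B}.
        (\<lambda>n. real (size (filter_mset (\<lambda>a. 1 \<le> significand B a \<and> significand B a \<le> s) (A n)))
               / real (size (A n))) \<longlonglongrightarrow> log B s)"

(* Points of R^d are the extensional functions on {..<d}, so that the dimension may vary. *)

abbreviation euclid :: "nat \<Rightarrow> (nat \<Rightarrow> real) measure" where
  "euclid d \<equiv> Pi\<^sub>M {..<d} (\<lambda>_. lborel)"

abbreviation unit_cube :: "nat \<Rightarrow> (nat \<Rightarrow> real) set" where
  "unit_cube d \<equiv> Pi\<^sub>E {..<d} (\<lambda>_. {0..1})"

definition rk :: "nat \<Rightarrow> (nat \<Rightarrow> real) \<Rightarrow> nat \<Rightarrow> real" where
  "rk d x i = (if i = 0 then 0 else if i \<le> d then sort (map x [0..<d]) ! (i - 1) else 1)"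

definition gap :: "nat \<Rightarrow> (nat \<Rightarrow> real) \<Rightarrow> nat \<Rightarrow> real" where
  "gap d x i = rk d x (Suc i) - rk d x i"

definition holder_continuous_on :: "real set \<Rightarrow> (real \<Rightarrow> real) \<Rightarrow> bool" where
  "holder_continuous_on S f \<longleftrightarrow>
     (\<exists>C \<alpha>. 0 < \<alpha> \<and> \<alpha> \<le> 1 \<and> (\<forall>x\<in>S. \<forall>y\<in>S. \<bar>f x - f y\<bar> \<le> C * \<bar>x - y\<bar> powr \<alpha>))"

(* A gap takes values in [0,1], and Hoelder continuity of its density is required on [0,1] only:
   for the uniform distribution on [0,1] the density of a gap jumps at 0 and 1 as a function
   on the whole line. *)

definition has_holder_density :: "'a measure \<Rightarrow> ('a \<Rightarrow> real) \<Rightarrow> bool" where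
  "has_holder_density M Y \<longleftrightarrow>
     (\<exists>f. (\<forall>t\<in>{0..1}. 0 \<le> f t) \<and> holder_continuous_on {0..1} f \<and>
          distributed M lborel Y (\<lambda>t. ennreal (f t * indicator {0..1} t)))"

(* For d = 0 the only gap is the constant 1, which has no density; goodness is vacuous there. *)

definition good_distribution :: "nat \<Rightarrow> (nat \<Rightarrow> real) measure \<Rightarrow> bool" where
  "good_distribution d D \<longleftrightarrow>
     prob_space D \<and> sets D = sets (euclid d) \<and> (AE x in D. x \<in> unit_cube d) \<and>
     (d > 0 \<longrightarrow> (\<forall>i\<le>d. has_holder_density D (\<lambda>x. gap d x i)))"

definition has_density_on_cube :: "nat \<Rightarrow> (nat \<Rightarrow> real) measure \<Rightarrow> bool" where
  "has_density_on_cube d D \<longleftrightarrow>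
     (\<exists>f\<in>borel_measurable (euclid d).
        (\<forall>x\<in>space (euclid d) - unit_cube d. f x = 0) \<and> D = density (euclid d) f)"

(* A stick is addressed by the list of the positions of its ancestors and itself among their
   siblings, most recent first: j # v is part number j of the stick v, and the length of the
   list is the level of the stick.  All sticks of level n are broken into \<kappa> n parts, and x v is
   the vector of cut points used on the stick v. *)

primrec sticks :: "(nat \<Rightarrow> nat) \<Rightarrow> nat \<Rightarrow> nat list set" where
  "sticks \<kappa> 0 = {[]}"
| "sticks \<kappa> (Suc n) = (\<lambda>(j, v). j # v) ` ({..<\<kappa> n} \<times> sticks \<kappa> n)"

primrec stick_length :: "(nat \<Rightarrow> nat) \<Rightarrow> (nat list \<Rightarrow> nat \<Rightarrow> real) \<Rightarrow> real \<Rightarrow> nat list \<Rightarrow> real" where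
  "stick_length \<kappa> x L [] = L"
| "stick_length \<kappa> x L (j # v) = stick_length \<kappa> x L v * gap (\<kappa> (length v) - 1) (x v) j"

definition stick_lengths ::
  "(nat \<Rightarrow> nat) \<Rightarrow> (nat list \<Rightarrow> nat \<Rightarrow> real) \<Rightarrow> real \<Rightarrow> nat \<Rightarrow> real multiset" where
  "stick_lengths \<kappa> x L N = image_mset (stick_length \<kappa> x L) (mset_set (sticks \<kappa> N))"

(* The random data of the process, on a probability space M:
   - K n is the number of parts into which the sticks of level n are broken;
   - C v is the distribution selected for breaking the stick v.  The selection is arbitrary
     within the family allowed at that level, possibly random and depending on v and on the
     numbers K, but it does not depend on the sampled cut points;
   - X v D is a fresh sample from D, available for breaking the stick v.
   The stick v is cut at X v (C v). *)

definition breaking_process ::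
  "'a measure \<Rightarrow> nat pmf \<Rightarrow> (nat \<Rightarrow> (nat \<Rightarrow> real) measure set) \<Rightarrow>
   (nat \<Rightarrow> 'a \<Rightarrow> nat) \<Rightarrow> (nat list \<Rightarrow> 'a \<Rightarrow> (nat \<Rightarrow> real) measure) \<Rightarrow>
   (nat list \<Rightarrow> (nat \<Rightarrow> real) measure \<Rightarrow> 'a \<Rightarrow> nat \<Rightarrow> real) \<Rightarrow> bool" where
  "breaking_process M G F K C X \<longleftrightarrow>
     (let I = UNIV \<times> (\<Union>k\<in>set_pmf G. F k) in
       prob_space M \<and>
       prob_space.indep_vars M (\<lambda>_. count_space UNIV) K UNIV \<and>
       (\<forall>n. distr M (count_space UNIV) (K n) = measure_pmf G) \<and>
       (\<forall>v. C v \<in> measurable M (count_space UNIV)) \<and>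
       (\<forall>v. AE \<omega> in M. C v \<omega> \<in> F (K (length v) \<omega>)) \<and>
       (\<forall>(v, D)\<in>I. X v D \<in> measurable M D \<and> distr M D (X v D) = D) \<and>
       prob_space.indep_vars M (\<lambda>(v, D). D) (\<lambda>(v, D). X v D) I \<and>
       prob_space.indep_set M
         (sets (vimage_algebra (space M) (\<lambda>\<omega>. (\<lambda>n. K n \<omega>, \<lambda>v. C v \<omega>))
            (Pi\<^sub>M UNIV (\<lambda>_. count_space UNIV) \<Otimes>\<^sub>M Pi\<^sub>M UNIV (\<lambda>_. count_space UNIV))))
         (sets (vimage_algebra (space M) (\<lambda>\<omega>. \<lambda>(v, D)\<in>I. X v D \<omega>)
            (Pi\<^sub>M I (\<lambda>(v, D). D)))))"

end

theory Submission
  imports Defs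
begin

text \<open>
  By Weyl's criterion the stick lengths show strong Benford behaviour once, for each integer
  \<open>h \<noteq> 0\<close>, the average of \<open>cis (\<theta> * ln a)\<close> over the lengths \<open>a\<close> at level \<open>N\<close> tends to 0, where
  \<open>\<theta> = 2 * pi * h / ln B\<close> (\<open>strong_benford_limitI\<close>).  A length is \<open>L\<close> times a product of gaps, so
  this is an average of products of gap phases along the paths of a tree.  There are countably many
  frequencies, and each can be treated separately.

  A gap of a genuinely broken stick has a density, so its phase is not almost surely constant and its
  mean has norm below 1, uniformly over the finitely many distributions
  (\<open>norm_expectation_phase_less_1\<close>).  First let the numbers of parts and the selected distributions
  be deterministic.  For the weighted phase sums with arbitrary weights of norm at most 1, let \<open>b n\<close>
  bound the second moment at level \<open>n\<close>, divided by the square of the number of sticks.  Integrating out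
  the cuts of the last level first, a breaking level gives
  \<open>b (Suc n) \<le> \<rho>\<^sup>2 * b n + 1 / card (sticks \<kappa> n)\<close>, since distinct sticks are cut
  independently; an unbroken level changes nothing.  As each breaking at least doubles the number of
  sticks, \<open>b n\<close> decays geometrically in the number of breaking levels
  (\<open>second_moment_phase_sum\<close>).

  The actual choices are random but independent of the samples, and only finitely many combinations
  matter up to a given level.  Summing over them, the second moment at level \<open>n\<close> is at most a constant
  times \<open>\<beta> ^ n\<close> with \<open>\<beta> < 1\<close>, because each level breaks the sticks with probability
  \<open>1 - pmf G 1 > 0\<close>, independently of the others.  These bounds are summable, so the averages tend
  to 0 almost surely (\<open>AE_mean_phase_tendsto_0\<close>).
\<close>

section \<open>Equidistribution modulo one\<close>

definition circle_mean :: "(complex \<Rightarrow> complex) \<Rightarrow> complex" where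
  "circle_mean f = integral {0..1} (\<lambda>t. f (cis (2 * pi * t)))"

text \<open>
  The test functions with which equidistribution is established, along the points
  \<^term>\<open>cis (2 * pi * x N v)\<close> of the unit circle: the lemmas below enlarge this class from the integral
  powers of \<open>z\<close> to the real polynomials in the two coordinates.
\<close>
definition averages_to_mean ::
  "(nat \<Rightarrow> 'b set) \<Rightarrow> (nat \<Rightarrow> 'b \<Rightarrow> real) \<Rightarrow> (complex \<Rightarrow> complex) \<Rightarrow> bool" where
  "averages_to_mean V x f \<longleftrightarrow> continuous_on (sphere 0 1) f \<and>
     (\<lambda>N. (\<Sum>v\<in>V N. f (cis (2 * pi * x N v))) / of_nat (card (V N))) \<longlonglongrightarrow> circle_mean f"

lemma cis_in_circle: "cis t \<in> sphere 0 1"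
  by simp

lemma continuous_on_circle_param:
  assumes "continuous_on (sphere 0 1) f"
  shows "continuous_on S (\<lambda>t. f (cis (2 * pi * t)))"
  by (rule continuous_on_compose2[OF assms]) (auto intro!: continuous_intros)

lemma averages_to_mean_cong:
  assumes "averages_to_mean V x f" "\<And>z. cmod z = 1 \<Longrightarrow> g z = f z"
  shows "averages_to_mean V x g"
proof -
  have "continuous_on (sphere 0 1) g = continuous_on (sphere 0 1) f"
    by (rule continuous_on_cong) (auto simp: assms(2))
  then show ?thesis
    using assms by (simp add: averages_to_mean_def circle_mean_def)
qed

lemma averages_to_mean_add:
  assumes "averages_to_mean V x f" "averages_to_mean V x g"
  shows "averages_to_mean V x (\<lambda>z. f z + g z)"
proof -
  have "circle_mean (\<lambda>z. f z + g z) = circle_mean f + circle_mean g"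
    unfolding circle_mean_def using assms
    by (intro integral_add integrable_continuous_interval continuous_on_circle_param)
      (auto simp: averages_to_mean_def)
  then show ?thesis
    using assms
    by (auto simp: averages_to_mean_def sum.distrib add_divide_distrib
        intro!: continuous_intros tendsto_add)
qed

lemma averages_to_mean_cmult:
  assumes "averages_to_mean V x f"
  shows "averages_to_mean V x (\<lambda>z. c * f z)"
proof -
  have "circle_mean (\<lambda>z. c * f z) = c * circle_mean f"
    unfolding circle_mean_def by (rule integral_mult_right)
  moreover have "(\<lambda>N. (\<Sum>v\<in>V N. c * f (cis (2 * pi * x N v))) / of_nat (card (V N)))
      = (\<lambda>N. c * ((\<Sum>v\<in>V N. f (cis (2 * pi * x N v))) / of_nat (card (V N))))"
    by (simp add: sum_distrib_left)
  ultimately show ?thesis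
    using assms unfolding averages_to_mean_def
    by (auto intro!: continuous_on_mult continuous_on_const tendsto_mult simp del: times_divide_eq_right)
qed

lemma circle_mean_powi:
  "circle_mean (\<lambda>z. z powi h) = (if h = 0 then 1 else 0)"
proof (cases "h = 0")
  case True
  then show ?thesis by (simp add: circle_mean_def)
next
  case False
  define c where "c = of_int h * (2 * pi)"
  have c: "c \<noteq> 0" using False by (simp add: c_def)
  define F where "F t = cis (c * t) / (\<i> * c)" for t
  have deriv: "(F has_vector_derivative cis (c * t)) (at t within {0..1})" for t
  proof -
    have "((\<lambda>t. cis (c * t)) has_vector_derivative (c *\<^sub>R (\<i> * cis (c * t)))) (at t within {0..1})"
    proof -
      have "((\<lambda>t. exp (\<i> * complex_of_real c * complex_of_real t)) has_vector_derivative
          (\<i> * c) * exp (\<i> * c * t)) (at t within {0..1})"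
        by (rule has_vector_derivative_real_field) (auto intro!: derivative_eq_intros)
      then show ?thesis
        by (simp add: cis_conv_exp scaleR_conv_of_real algebra_simps)
    qed
    from has_vector_derivative_divide[OF this, of "\<i> * c"] show ?thesis
      unfolding F_def using c by (simp add: scaleR_conv_of_real field_simps)
  qed
  have "((\<lambda>t. cis (c * t)) has_integral (F 1 - F 0)) {0..1}"
    by (rule fundamental_theorem_of_calculus) (auto intro: deriv)
  moreover have "F 1 - F 0 = 0"
  proof -
    have "cis c = 1"
      unfolding c_def using cis_power_int[of "2 * pi" h] by simp
    then show ?thesis by (simp add: F_def)
  qed
  ultimately show ?thesis
    using False unfolding circle_mean_def
    by (simp add: cis_power_int c_def mult.assoc integral_unique)
qed

text \<open>
  On the circle \<open>inverse z = cnj z\<close>, so a real linear function is \<open>\<alpha> * z + \<beta> * inverse z\<close> and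
  multiplication by it only shifts exponents.  Carrying the arbitrary factor \<open>f\<close> and all shifts \<open>h\<close> through the induction turns a
  product of two polynomials into two successive multiplications, so that no normal form of
  trigonometric polynomials has to be handled.
\<close>
lemma real_polynomial_averages:
  assumes "real_polynomial_function g"
    and "\<And>h. averages_to_mean V x (\<lambda>z. z powi h * f z)"
  shows "averages_to_mean V x (\<lambda>z. z powi h * (of_real (g z) * f z))"
  using assms
proof (induction g arbitrary: f h rule: real_polynomial_function.induct)
  case (linear g)
  \<comment> \<open>The coefficients of \<open>Re z * g 1 + Im z * g \<i>\<close> after \<open>Re z = (z + inverse z) / 2\<close> and
      \<open>Im z = (z - inverse z) / (2 * \<i>)\<close>.\<close>
  define \<alpha> where "\<alpha> = (of_real (g 1) - \<i> * of_real (g \<i>)) / 2"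
  define \<beta> where "\<beta> = (of_real (g 1) + \<i> * of_real (g \<i>)) / 2"
  have lin: "complex_of_real (g z) = \<alpha> * z + \<beta> * inverse z" if z: "cmod z = 1" for z
  proof -
    interpret g: bounded_linear g by fact
    have "z = Re z *\<^sub>R 1 + Im z *\<^sub>R \<i>"
      by (simp add: complex_eq_iff)
    then have "g z = Re z * g 1 + Im z * g \<i>"
      by (metis g.add g.scaleR real_scaleR_def)
    moreover have "inverse z = cnj z"
      using z by (simp add: inverse_complex_def complex_eq_iff cmod_def)
    ultimately show ?thesis
      by (simp add: \<alpha>_def \<beta>_def complex_eq_iff algebra_simps add_divide_distrib diff_divide_distrib)
  qed
  have "averages_to_mean V x (\<lambda>z. \<alpha> * (z powi (h + 1) * f z) + \<beta> * (z powi (h - 1) * f z))"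
    using linear.prems by (intro averages_to_mean_add averages_to_mean_cmult)
  then show ?case
  proof (rule averages_to_mean_cong)
    fix z :: complex assume z: "cmod z = 1"
    then have "z \<noteq> 0" by auto
    then show "z powi h * (of_real (g z) * f z) =
        \<alpha> * (z powi (h + 1) * f z) + \<beta> * (z powi (h - 1) * f z)"
      unfolding lin[OF z] by (simp add: power_int_add power_int_diff field_simps)
  qed
next
  case (const c)
  from averages_to_mean_cmult[OF const(1), of "of_real c" h] show ?case
    by (simp add: mult_ac)
next
  case (add g1 g2)
  from averages_to_mean_add[OF add.IH(1)[OF add.prems, of h] add.IH(2)[OF add.prems, of h]]
  show ?case by (simp add: algebra_simps)
next
  case (mult g1 g2)
  from mult.IH(1)[OF mult.IH(2)[OF mult.prems], of h] show ?case
    by (simp add: algebra_simps)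
qed

locale vanishing_exponential_sums =
  fixes V :: "nat \<Rightarrow> 'b set" and x :: "nat \<Rightarrow> 'b \<Rightarrow> real"
  assumes finite_V: "finite (V N)" and nonempty_V: "V N \<noteq> {}"
    and exponential_sums: "h \<noteq> 0 \<Longrightarrow>
      (\<lambda>N. (\<Sum>v\<in>V N. cis (2 * pi * of_int h * x N v)) / of_nat (card (V N))) \<longlonglongrightarrow> 0"
begin

lemma card_pos: "0 < real (card (V N))"
  using finite_V nonempty_V by (simp add: card_gt_0_iff)

lemma averages_powi: "averages_to_mean V x (\<lambda>z. z powi h)"
proof -
  have "(\<lambda>N. (\<Sum>v\<in>V N. cis (2 * pi * x N v) powi h) / of_nat (card (V N)))
      \<longlonglongrightarrow> (if h = 0 then 1 else 0)"
  proof (cases "h = 0")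
    case True
    have "of_nat (card (V N)) / of_nat (card (V N)) = (1::complex)" for N
      using finite_V nonempty_V by simp
    with True show ?thesis by (simp del: divide_self_if)
  next
    case False
    with exponential_sums[of h] show ?thesis
      by (simp add: cis_power_int mult_ac)
  qed
  then show ?thesis
    unfolding averages_to_mean_def circle_mean_powi
    by (auto intro!: continuous_intros)
qed

text \<open>
  By the Stone-Weierstrass theorem a continuous function differs by at most \<open>e / 3\<close> on the circle
  from a real polynomial, for which the averages converge.
\<close>
lemma continuous_averages:
  fixes f :: "complex \<Rightarrow> real"
  assumes f: "continuous_on (sphere 0 1) f"
  shows "(\<lambda>N. (\<Sum>v\<in>V N. f (cis (2 * pi * x N v))) / real (card (V N)))
    \<longlonglongrightarrow> integral {0..1} (\<lambda>t. f (cis (2 * pi * t)))"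
proof (rule LIMSEQ_I)
  fix e :: real assume e: "e > 0"
  obtain g where g: "real_polynomial_function g"
    and fg: "\<And>z. z \<in> sphere 0 1 \<Longrightarrow> \<bar>f z - g z\<bar> < e / 3"
    using Stone_Weierstrass_real_polynomial_function[OF compact_sphere f, of "e/3"] e by auto
  have "averages_to_mean V x (\<lambda>z. z powi 0 * (of_real (g z) * 1))"
    using averages_powi by (intro real_polynomial_averages[OF g]) simp
  then have g_av: "averages_to_mean V x (\<lambda>z. of_real (g z))" by simp
  have "continuous_on (sphere 0 1) (\<lambda>z. Re (complex_of_real (g z)))"
    using g_av unfolding averages_to_mean_def by (intro continuous_on_Re) auto
  then have g_cont: "continuous_on (sphere 0 1) g" by simp
  define If where "If = integral {0..1} (\<lambda>t. f (cis (2 * pi * t)))"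
  define Ig where "Ig = integral {0..1} (\<lambda>t. g (cis (2 * pi * t)))"
  define Sf where "Sf N = (\<Sum>v\<in>V N. f (cis (2 * pi * x N v))) / real (card (V N))" for N
  define Sg where "Sg N = (\<Sum>v\<in>V N. g (cis (2 * pi * x N v))) / real (card (V N))" for N
  have int: "(\<lambda>t. f (cis (2 * pi * t))) integrable_on {0..1}"
    "(\<lambda>t. g (cis (2 * pi * t))) integrable_on {0..1}"
    by (intro integrable_continuous_interval continuous_on_circle_param f g_cont)+
  have "(\<lambda>N. complex_of_real (Sg N)) \<longlonglongrightarrow> circle_mean (\<lambda>z. of_real (g z))"
    using g_av by (simp add: averages_to_mean_def Sg_def)
  moreover have "circle_mean (\<lambda>z. of_real (g z)) = of_real Ig"
    unfolding circle_mean_def Ig_def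
    by (intro integral_unique has_integral_of_real integrable_integral int)
  ultimately have "Sg \<longlonglongrightarrow> Ig" by (simp add: tendsto_of_real_iff)
  then obtain N0 where N0: "\<And>N. N \<ge> N0 \<Longrightarrow> norm (Sg N - Ig) < e / 3"
    using LIMSEQ_D[of Sg Ig "e/3"] e by auto
  have "norm (If - Ig) \<le> e / 3"
  proof -
    have "If - Ig = integral {0..1} (\<lambda>t. f (cis (2 * pi * t)) - g (cis (2 * pi * t)))"
      unfolding If_def Ig_def using int by (simp add: integral_diff)
    also have "norm \<dots> \<le> integral {0..1} (\<lambda>t::real. e / 3)"
      using int fg[OF cis_in_circle]
      by (intro integral_norm_bound_integral integrable_diff) (auto intro: less_imp_le)
    finally show ?thesis by simp
  qed
  have Sf_Sg: "norm (Sf N - Sg N) \<le> e / 3" for N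
  proof -
    have "Sf N - Sg N = (\<Sum>v\<in>V N. f (cis (2 * pi * x N v)) - g (cis (2 * pi * x N v)))
        / real (card (V N))"
      by (simp add: Sf_def Sg_def sum_subtractf diff_divide_distrib)
    also have "norm \<dots> \<le> (\<Sum>v\<in>V N. e / 3) / real (card (V N))"
    proof -
      have "norm (\<Sum>v\<in>V N. f (cis (2 * pi * x N v)) - g (cis (2 * pi * x N v))) \<le> (\<Sum>v\<in>V N. e / 3)"
        using fg[OF cis_in_circle] by (intro sum_norm_le) (auto intro: less_imp_le)
      then show ?thesis
        unfolding norm_divide using card_pos[of N] by (simp add: field_simps)
    qed
    also have "\<dots> = e / 3" using card_pos[of N] by simp
    finally show ?thesis .
  qed
  have "norm (Sf N - If) < e" if "N \<ge> N0" for N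
  proof -
    show ?thesis
      using N0[OF that] \<open>norm (If - Ig) \<le> e / 3\<close> Sf_Sg[of N]
      unfolding real_norm_def by linarith
  qed
  then show "\<exists>N0. \<forall>N\<ge>N0. norm ((\<Sum>v\<in>V N. f (cis (2 * pi * x N v))) / real (card (V N))
      - integral {0..1} (\<lambda>t. f (cis (2 * pi * t)))) < e"
    unfolding Sf_def If_def by blast
qed


text \<open>
  Only lower bounds for open arcs are proved: an upper bound for an arc is a lower bound for the
  complementary one.  The indicator of the arc around \<open>\<mu>\<close> of half-width \<open>w\<close> is bounded below by a
  continuous function of \<open>cos (2 * pi * (t - \<mu>))\<close>, the real part of the rotated point on the circle;
  this respects the period, so that the ends \<open>0\<close> and \<open>1\<close> need no separate treatment.
\<close>
lemma arc_frequency_lower_bound: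
  assumes ab: "0 \<le> a" "a < b" "b \<le> 1" and e: "e > 0"
  shows "\<forall>\<^sub>F N in sequentially.
    b - a - e < real (card {v \<in> V N. a < frac (x N v) \<and> frac (x N v) < b}) / real (card (V N))"
proof -
  define \<mu> where "\<mu> = (a + b) / 2"
  define w where "w = (b - a) / 2"
  \<comment> \<open>On the smaller arc of half-width \<open>w'\<close> the test function equals 1; its length exceeds \<open>b - a - e\<close>.\<close>
  define w' where "w' = max (w / 2) (w - e / 4)"
  have w: "0 < w'" "w' < w" "2 * w - e < 2 * w'" "w \<le> 1 / 2" "w \<le> \<mu>" "\<mu> \<le> 1 - w"
    using ab e by (auto simp: w_def w'_def \<mu>_def field_simps max_def)
  define \<delta> where "\<delta> = cos (2 * pi * w') - cos (2 * pi * w)"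
  have "\<delta> > 0"
    unfolding \<delta>_def using w by (simp add: cos_monotone_0_pi)
  define f where "f z = max 0 (min 1 ((Re (z * cis (- (2 * pi * \<mu>))) - cos (2 * pi * w)) / \<delta>))" for z
  have f_cis: "f (cis (2 * pi * t)) = max 0 (min 1 ((cos (2 * pi * (t - \<mu>)) - cos (2 * pi * w)) / \<delta>))" for t
    unfolding f_def cis_mult by (simp add: algebra_simps)
  have f_cont: "continuous_on (sphere 0 1) f"
    unfolding f_def using \<open>\<delta> > 0\<close> by (intro continuous_intros) auto
  have f_int: "(\<lambda>t. f (cis (2 * pi * t))) integrable_on {u..v}" for u v :: real
    by (intro integrable_continuous_interval continuous_on_circle_param f_cont)
  have "2 * w' \<le> integral {0..1} (\<lambda>t. f (cis (2 * pi * t)))"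
  proof -
    have f_1: "f (cis (2 * pi * t)) = 1" if t: "t \<in> {\<mu> - w'..\<mu> + w'}" for t
    proof -
      have "\<bar>t - \<mu>\<bar> \<le> w'" using t by auto
      then have "cos (2 * pi * w') \<le> cos (2 * pi * \<bar>t - \<mu>\<bar>)"
        using w by (intro cos_monotone_0_pi_le) auto
      also have "\<dots> = cos (2 * pi * (t - \<mu>))"
        by (auto simp: abs_if algebra_simps) (metis cos_minus minus_diff_eq)
      finally have "\<delta> \<le> cos (2 * pi * (t - \<mu>)) - cos (2 * pi * w)"
        by (simp add: \<delta>_def)
      then show ?thesis
        unfolding f_cis using \<open>\<delta> > 0\<close> by (simp add: min_def field_simps)
    qed
    have "2 * w' = integral {\<mu> - w'..\<mu> + w'} (\<lambda>t. 1)"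
      using w by simp
    also have "\<dots> = integral {\<mu> - w'..\<mu> + w'} (\<lambda>t. f (cis (2 * pi * t)))"
      by (rule integral_cong) (simp only: f_1)
    also have "\<dots> \<le> integral {0..1} (\<lambda>t. f (cis (2 * pi * t)))"
      using w by (intro integral_subset_le f_int) (auto simp: f_def)
    finally show ?thesis .
  qed
  then have "b - a - e < integral {0..1} (\<lambda>t. f (cis (2 * pi * t)))"
    using w(3) unfolding w_def by (simp add: field_simps)
  from order_tendstoD(1)[OF continuous_averages[OF f_cont] this]
  show ?thesis
  proof (rule eventually_mono)
    fix N
    let ?P = "\<lambda>v. a < frac (x N v) \<and> frac (x N v) < b"
    have "f (cis (2 * pi * x N v)) \<le> (if ?P v then 1 else 0)" for v
    proof (cases "?P v")
      case True
      then show ?thesis by (simp add: f_def)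
    next
      case False
      define y where "y = frac (x N v) - \<mu>"
      have "0 \<le> frac (x N v)" "frac (x N v) < 1"
        by (simp_all add: frac_lt_1)
      moreover have "\<mu> - w = a" "\<mu> + w = b"
        by (simp_all add: \<mu>_def w_def field_simps)
      ultimately have y: "w \<le> \<bar>y\<bar>" "\<bar>y\<bar> \<le> 1 - w"
        using False w ab unfolding y_def by linarith+
      have "2 * pi * (x N v - \<mu>) = 2 * pi * y + 2 * pi * of_int \<lfloor>x N v\<rfloor>"
        by (simp add: y_def frac_def algebra_simps)
      then have "cos (2 * pi * (x N v - \<mu>)) = cos (2 * pi * y)"
        by (metis sin_cos_eq_iff)
      also have "\<dots> = cos (2 * pi * \<bar>y\<bar>)"
        by (auto simp: abs_if)
      also have "\<dots> \<le> cos (2 * pi * w)"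
      proof (cases "\<bar>y\<bar> \<le> 1 / 2")
        case True
        then show ?thesis using y w by (intro cos_monotone_0_pi_le) auto
      next
        case False
        \<comment> \<open>Beyond half a turn the cosine increases again, and \<open>\<bar>y\<bar> \<le> 1 - w\<close> is the relevant bound.\<close>
        have "cos (2 * pi * \<bar>y\<bar>) = cos (2 * pi - 2 * pi * \<bar>y\<bar>)"
          by (simp add: cos_diff)
        also have "\<dots> = cos (2 * pi * (1 - \<bar>y\<bar>))"
          by (simp add: algebra_simps)
        also have "\<dots> \<le> cos (2 * pi * w)"
          using y w False by (intro cos_monotone_0_pi_le) auto
        finally show ?thesis .
      qed
      finally show ?thesis
        unfolding f_cis using False \<open>\<delta> > 0\<close> by (auto simp: max_def min_def field_simps)
    qed
    then have "(\<Sum>v\<in>V N. f (cis (2 * pi * x N v))) \<le> (\<Sum>v\<in>V N. if ?P v then 1 else 0)"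
      by (intro sum_mono)
    also have "\<dots> = real (card {v \<in> V N. ?P v})"
      using finite_V by (simp add: sum.If_cases Int_def)
    finally have *: "(\<Sum>v\<in>V N. f (cis (2 * pi * x N v))) / real (card (V N))
        \<le> real (card {v \<in> V N. ?P v}) / real (card (V N))"
      by (intro divide_right_mono) auto
    assume "b - a - e < (\<Sum>v\<in>V N. f (cis (2 * pi * x N v))) / real (card (V N))"
    with * show "b - a - e < real (card {v \<in> V N. ?P v}) / real (card (V N))" by linarith
  qed
qed

proposition weyl_equidistribution:
  assumes a: "0 \<le> a" "a \<le> 1"
  shows "(\<lambda>N. real (card {v \<in> V N. frac (x N v) \<le> a}) / real (card (V N))) \<longlonglongrightarrow> a"
proof (rule order_tendstoI)
  fix c assume c: "c < a"
  show "\<forall>\<^sub>F N in sequentially. c < real (card {v \<in> V N. frac (x N v) \<le> a}) / real (card (V N))"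
  proof (cases "a = 0")
    case True
    with c show ?thesis by (intro always_eventually allI) (auto intro: less_le_trans)
  next
    case False
    with a have "0 < a" by simp
    from arc_frequency_lower_bound[OF _ this a(2), of "a - c"] c
    have "\<forall>\<^sub>F N in sequentially. c < real (card {v \<in> V N. 0 < frac (x N v) \<and> frac (x N v) < a}) / real (card (V N))"
      by simp
    then show ?thesis
    proof (rule eventually_mono)
      fix N assume "c < real (card {v \<in> V N. 0 < frac (x N v) \<and> frac (x N v) < a}) / real (card (V N))"
      also have "\<dots> \<le> real (card {v \<in> V N. frac (x N v) \<le> a}) / real (card (V N))"
        using finite_V by (intro divide_right_mono) (auto intro!: card_mono)
      finally show "c < real (card {v \<in> V N. frac (x N v) \<le> a}) / real (card (V N))" .
    qed
  qed
next
  fix c assume c: "a < c"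
  have compl: "real (card {v \<in> V N. frac (x N v) \<le> a}) / real (card (V N))
      = 1 - real (card {v \<in> V N. a < frac (x N v)}) / real (card (V N))" for N
  proof -
    have "card {v \<in> V N. frac (x N v) \<le> a} + card {v \<in> V N. a < frac (x N v)}
        = card ({v \<in> V N. frac (x N v) \<le> a} \<union> {v \<in> V N. a < frac (x N v)})"
      using finite_V by (subst card_Un_disjoint) auto
    also have "{v \<in> V N. frac (x N v) \<le> a} \<union> {v \<in> V N. a < frac (x N v)} = V N"
      by auto
    finally show ?thesis
      using card_pos[of N] by (simp add: field_simps flip: of_nat_add)
  qed
  show "\<forall>\<^sub>F N in sequentially. real (card {v \<in> V N. frac (x N v) \<le> a}) / real (card (V N)) < c"
  proof (cases "a = 1")
    case True
    with c show ?thesis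
      unfolding compl by (intro always_eventually allI) (auto intro: le_less_trans[of _ 1])
  next
    case False
    with a have "a < 1" by simp
    from arc_frequency_lower_bound[OF a(1) this order_refl, of "c - a"] c
    have "\<forall>\<^sub>F N in sequentially. 1 - c < real (card {v \<in> V N. a < frac (x N v)}) / real (card (V N))"
      by (simp add: frac_lt_1)
    then show ?thesis
      unfolding compl by (rule eventually_mono) simp
  qed
qed

end

section \<open>Significands and logarithms\<close>

lemma significand_eq_powr_frac:
  assumes B: "1 < B" and a: "0 < a"
  shows "significand B a = B powr frac (log B a)"
  unfolding significand_def
proof (rule the_equality)
  have "a = B powr (frac (log B a) + of_int \<lfloor>log B a\<rfloor>)"
    using assms by (simp add: frac_def)
  also have "\<dots> = B powr frac (log B a) * B powi \<lfloor>log B a\<rfloor>"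
    using B by (simp add: powr_add powr_real_of_int')
  finally have "a = B powr frac (log B a) * B powi \<lfloor>log B a\<rfloor>" .
  moreover have "B powr frac (log B a) < B powr 1"
    using B by (intro powr_less_mono) (simp_all add: frac_lt_1)
  ultimately show "1 \<le> B powr frac (log B a) \<and> B powr frac (log B a) < B \<and>
      (\<exists>j::int. a = B powr frac (log B a) * B powi j)"
    using B by (auto intro: ge_one_powr_ge_zero)
next
  fix s assume "1 \<le> s \<and> s < B \<and> (\<exists>j::int. a = s * B powi j)"
  then obtain j where s: "1 \<le> s" "s < B" and j: "a = s * B powi j" by auto
  have "log B a = log B s + of_int j"
    using s B unfolding j by (simp add: log_mult powr_real_of_int' flip: powr_real_of_int')
  moreover have "0 \<le> log B s" "log B s < 1"
    using s B by (simp_all add: zero_le_log_cancel_iff)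
  ultimately have "frac (log B a) = log B s"
    by (simp add: frac_unique_iff)
  then show "s = B powr frac (log B a)"
    using s B by simp
qed

text \<open>
  The significand of \<open>a\<close> is determined by \<open>log B a\<close> modulo one, so strong Benford behaviour is the
  equidistribution of these logarithms, and Weyl's criterion reduces it to exponential sums.
\<close>
lemma strong_benford_limitI:
  fixes V :: "nat \<Rightarrow> 'b set" and len :: "nat \<Rightarrow> 'b \<Rightarrow> real"
  assumes B: "1 < B" and V: "\<And>N. finite (V N)" "\<And>N. V N \<noteq> {}"
    and pos: "\<And>N v. v \<in> V N \<Longrightarrow> 0 < len N v"
    and sums: "\<And>h::int. h \<noteq> 0 \<Longrightarrow>
      (\<lambda>N. (\<Sum>v\<in>V N. cis (2 * pi * of_int h / ln B * ln (len N v))) / of_nat (card (V N))) \<longlonglongrightarrow> 0"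
  shows "strong_benford_limit B (\<lambda>N. image_mset (len N) (mset_set (V N)))"
proof -
  interpret vanishing_exponential_sums V "\<lambda>N v. log B (len N v)"
    using V sums by unfold_locales (auto simp: log_def)
  have "(\<lambda>N. real (size (filter_mset (\<lambda>a. 1 \<le> significand B a \<and> significand B a \<le> s)
      (image_mset (len N) (mset_set (V N))))) / real (size (image_mset (len N) (mset_set (V N)))))
      \<longlonglongrightarrow> log B s" if s: "s \<in> {1..<B}" for s
  proof -
    have "1 \<le> significand B (len N v) \<and> significand B (len N v) \<le> s
        \<longleftrightarrow> frac (log B (len N v)) \<le> log B s" if "v \<in> V N" for N v
    proof -
      have "1 \<le> B powr frac (log B (len N v))"
        using B by (intro ge_one_powr_ge_zero) auto
      then show ?thesis
        using B s pos[OF that] by (simp add: significand_eq_powr_frac le_log_iff)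
    qed
    then have "{v \<in> V N. 1 \<le> significand B (len N v) \<and> significand B (len N v) \<le> s}
        = {v \<in> V N. frac (log B (len N v)) \<le> log B s}" for N
      by auto
    moreover have "0 \<le> log B s" "log B s \<le> 1"
      using B s by (auto simp: zero_le_log_cancel_iff)
    ultimately show ?thesis
      using weyl_equidistribution[of "log B s"] V
      by (simp add: filter_mset_image_mset o_def)
  qed
  then show ?thesis
    using V pos unfolding strong_benford_limit_def by auto
qed

section \<open>Second moments of products along a tree\<close>

lemma length_stick: "v \<in> sticks \<kappa> n \<Longrightarrow> length v = n"
  by (induction n arbitrary: v) auto

lemma finite_sticks: "finite (sticks \<kappa> n)"
  by (induction n) auto

lemma inj_on_Cons: "inj_on (\<lambda>(j, v). j # v) A"
  by (auto intro!: inj_onI)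

lemma card_sticks_Suc: "card (sticks \<kappa> (Suc n)) = \<kappa> n * card (sticks \<kappa> n)"
  using card_image[OF inj_on_Cons, of "{..<\<kappa> n} \<times> sticks \<kappa> n"]
  by (simp add: card_cartesian_product)

lemma card_sticks: "card (sticks \<kappa> n) = (\<Prod>i<n. \<kappa> i)"
  by (induction n) (simp_all add: card_sticks_Suc mult.commute del: sticks.simps(2))

lemma sum_sticks_Suc:
  "(\<Sum>v\<in>sticks \<kappa> (Suc n). f v) = (\<Sum>v\<in>sticks \<kappa> n. \<Sum>j<\<kappa> n. f (j # v))"
proof -
  have "(\<Sum>v\<in>sticks \<kappa> (Suc n). f v) = (\<Sum>(j, v)\<in>{..<\<kappa> n} \<times> sticks \<kappa> n. f (j # v))"
    unfolding sticks.simps(2) sum.reindex[OF inj_on_Cons]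
    by (intro sum.cong) auto
  also have "\<dots> = (\<Sum>j<\<kappa> n. \<Sum>v\<in>sticks \<kappa> n. f (j # v))"
    by (simp add: sum.cartesian_product)
  finally show ?thesis by (simp add: sum.swap[of _ "sticks \<kappa> n"])
qed

text \<open>
  Addresses list the most recent position first, so the product runs over the ancestors of a stick
  like \<^const>\<open>stick_length\<close> does.
\<close>
primrec path_prod :: "(nat list \<Rightarrow> nat \<Rightarrow> complex) \<Rightarrow> nat list \<Rightarrow> complex" where
  "path_prod y [] = 1"
| "path_prod y (j # v) = path_prod y v * y v j"

lemma path_prod_cong:
  assumes "v \<in> sticks \<kappa> n" "\<And>k u j. k < n \<Longrightarrow> u \<in> sticks \<kappa> k \<Longrightarrow> y u j = y' u j"
  shows "path_prod y v = path_prod y' v"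
  using assms
proof (induction n arbitrary: v)
  case (Suc n)
  then obtain j u where v: "v = j # u" and u: "u \<in> sticks \<kappa> n" by auto
  have "path_prod y u = path_prod y' u"
    using Suc.prems(2) less_Suc_eq by (intro Suc.IH[OF u]) blast
  moreover have "y u j = y' u j"
    using Suc.prems(2)[OF lessI u] .
  ultimately show ?case by (simp add: v)
qed simp

lemma borel_measurable_cnj [measurable]:
  "f \<in> borel_measurable A \<Longrightarrow> (\<lambda>z. cnj (f z)) \<in> borel_measurable A"
  using measurable_compose[OF _ borel_measurable_continuous_onI[of cnj]] continuous_on_cnj by auto

lemma norm_path_prod_le_1:
  assumes "\<And>u j. cmod (y u j) \<le> 1"
  shows "cmod (path_prod y v) \<le> 1"
  by (induction v) (auto simp: norm_mult intro: mult_le_one assms)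

context prob_space begin

text \<open>
  Bilinear expansion of a second moment, kept in the complex numbers so that the mixed terms can be
  compared one by one.
\<close>
lemma expectation_norm_sum_square:
  fixes f :: "'v \<Rightarrow> 'a \<Rightarrow> complex"
  assumes [measurable]: "\<And>v. v \<in> V \<Longrightarrow> f v \<in> borel_measurable M"
    and bound: "\<And>v \<omega>. v \<in> V \<Longrightarrow> cmod (f v \<omega>) \<le> b"
  shows "complex_of_real (expectation (\<lambda>\<omega>. (cmod (\<Sum>v\<in>V. f v \<omega>))\<^sup>2))
    = (\<Sum>v\<in>V. \<Sum>u\<in>V. expectation (\<lambda>\<omega>. f v \<omega> * cnj (f u \<omega>)))"
proof -
  have int: "integrable M (\<lambda>\<omega>. f v \<omega> * cnj (f u \<omega>))" if "v \<in> V" "u \<in> V" for u v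
  proof (rule integrable_const_bound)
    show "AE \<omega> in M. cmod (f v \<omega> * cnj (f u \<omega>)) \<le> b * b"
      using mult_mono[OF bound[OF that(1)] bound[OF that(2)]] order_trans[OF norm_ge_zero bound[OF that(1)]]
      by (simp add: norm_mult)
    show "(\<lambda>\<omega>. f v \<omega> * cnj (f u \<omega>)) \<in> borel_measurable M"
      using that by measurable
  qed
  have "complex_of_real (expectation (\<lambda>\<omega>. (cmod (\<Sum>v\<in>V. f v \<omega>))\<^sup>2))
      = expectation (\<lambda>\<omega>. complex_of_real ((cmod (\<Sum>v\<in>V. f v \<omega>))\<^sup>2))"
    by (rule integral_complex_of_real[symmetric])
  also have "\<dots> = expectation (\<lambda>\<omega>. \<Sum>v\<in>V. \<Sum>u\<in>V. f v \<omega> * cnj (f u \<omega>))"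
    by (simp only: complex_norm_square cnj_sum sum_product)
  also have "\<dots> = (\<Sum>v\<in>V. \<Sum>u\<in>V. expectation (\<lambda>\<omega>. f v \<omega> * cnj (f u \<omega>)))"
    using int by (simp add: integral_sum integrable_sum)
  finally show ?thesis .
qed

text \<open>
  Meant for factors \<open>Y v\<close> that are independent of each other and of the \<open>\<phi> v\<close>, with means \<open>m v\<close>.
  Replacing \<open>Y v\<close> by \<open>m v\<close> then changes no mixed term of the expanded second moment, and each
  diagonal term is at most \<open>b\<^sup>2\<close> before and nonnegative after the replacement.
\<close>
lemma second_moment_replace_by_means:
  fixes \<phi> Y :: "'v \<Rightarrow> 'a \<Rightarrow> complex" and m :: "'v \<Rightarrow> complex"
  assumes fin: "finite V"
    and [measurable]: "\<And>v. v \<in> V \<Longrightarrow> \<phi> v \<in> borel_measurable M"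
      "\<And>v. v \<in> V \<Longrightarrow> Y v \<in> borel_measurable M"
    and \<phi>: "\<And>v \<omega>. v \<in> V \<Longrightarrow> cmod (\<phi> v \<omega>) \<le> 1"
    and Y: "\<And>v \<omega>. v \<in> V \<Longrightarrow> cmod (Y v \<omega>) \<le> b"
    and m: "\<And>v. v \<in> V \<Longrightarrow> cmod (m v) \<le> b"
    and uncorrelated: "\<And>v u. v \<in> V \<Longrightarrow> u \<in> V \<Longrightarrow> v \<noteq> u \<Longrightarrow>
      expectation (\<lambda>\<omega>. \<phi> v \<omega> * cnj (\<phi> u \<omega>) * (Y v \<omega> * cnj (Y u \<omega>)))
      = expectation (\<lambda>\<omega>. \<phi> v \<omega> * cnj (\<phi> u \<omega>)) * (m v * cnj (m u))"
  shows "expectation (\<lambda>\<omega>. (cmod (\<Sum>v\<in>V. \<phi> v \<omega> * Y v \<omega>))\<^sup>2)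
    \<le> expectation (\<lambda>\<omega>. (cmod (\<Sum>v\<in>V. \<phi> v \<omega> * m v))\<^sup>2) + b\<^sup>2 * card V"
proof -
  define S T where
    "S v u = expectation (\<lambda>\<omega>. \<phi> v \<omega> * Y v \<omega> * cnj (\<phi> u \<omega> * Y u \<omega>))" and
    "T v u = expectation (\<lambda>\<omega>. \<phi> v \<omega> * m v * cnj (\<phi> u \<omega> * m u))" for v u
  have off: "S v u = T v u" if "v \<in> V" "u \<in> V" "v \<noteq> u" for v u
  proof -
    have "T v u = expectation (\<lambda>\<omega>. \<phi> v \<omega> * cnj (\<phi> u \<omega>) * (m v * cnj (m u)))"
      unfolding T_def by (simp add: mult_ac)
    also have "\<dots> = S v u"
      using uncorrelated[OF that] unfolding S_def by (simp add: mult_ac)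
    finally show ?thesis ..
  qed
  have diag: "Re (S v v - T v v) \<le> b\<^sup>2" if v: "v \<in> V" for v
  proof -
    have \<phi>Y: "cmod (\<phi> v \<omega> * Y v \<omega>) \<le> b" for \<omega>
      using mult_mono[OF \<phi>[OF v] Y[OF v]] by (simp add: norm_mult)
    have "S v v = expectation (\<lambda>\<omega>. complex_of_real ((cmod (\<phi> v \<omega> * Y v \<omega>))\<^sup>2))"
      unfolding S_def by (simp only: complex_norm_square)
    then have "Re (S v v) = expectation (\<lambda>\<omega>. (cmod (\<phi> v \<omega> * Y v \<omega>))\<^sup>2)"
      by (simp only: integral_complex_of_real Re_complex_of_real)
    also have "\<dots> \<le> expectation (\<lambda>\<omega>. b\<^sup>2)"
      using \<phi>Y v by (intro integral_mono integrable_const_bound[where B="b\<^sup>2"])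
        (auto intro!: power_mono)
    finally have "Re (S v v) \<le> b\<^sup>2" by (simp add: prob_space)
    moreover have "T v v = expectation (\<lambda>\<omega>. complex_of_real ((cmod (\<phi> v \<omega> * m v))\<^sup>2))"
      unfolding T_def by (simp only: complex_norm_square)
    then have "Re (T v v) = expectation (\<lambda>\<omega>. (cmod (\<phi> v \<omega> * m v))\<^sup>2)"
      by (simp only: integral_complex_of_real Re_complex_of_real)
    then have "0 \<le> Re (T v v)" by simp
    ultimately show ?thesis by simp
  qed
  have "complex_of_real (expectation (\<lambda>\<omega>. (cmod (\<Sum>v\<in>V. \<phi> v \<omega> * Y v \<omega>))\<^sup>2))
      - complex_of_real (expectation (\<lambda>\<omega>. (cmod (\<Sum>v\<in>V. \<phi> v \<omega> * m v))\<^sup>2))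
      = (\<Sum>v\<in>V. \<Sum>u\<in>V. S v u) - (\<Sum>v\<in>V. \<Sum>u\<in>V. T v u)"
    unfolding S_def T_def
  proof (intro arg_cong2[of _ _ _ _ minus] expectation_norm_sum_square[where b=b])
    fix v \<omega> assume "v \<in> V"
    with mult_mono[OF \<phi>[OF this] Y[OF this], of \<omega> \<omega>] mult_mono[OF \<phi>[OF this] m[OF this], of \<omega>]
    show "cmod (\<phi> v \<omega> * Y v \<omega>) \<le> b" "cmod (\<phi> v \<omega> * m v) \<le> b"
      by (simp_all add: norm_mult)
  qed measurable
  also have "\<dots> = (\<Sum>v\<in>V. \<Sum>u\<in>V. S v u - T v u)"
    by (simp add: sum_subtractf)
  also have "\<dots> = (\<Sum>v\<in>V. S v v - T v v)"
  proof (rule sum.cong[OF refl])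
    fix v assume v: "v \<in> V"
    have "(\<Sum>u\<in>V. S v u - T v u) = (\<Sum>u\<in>V. if u = v then S v v - T v v else 0)"
      using off[OF v] by (intro sum.cong) auto
    then show "(\<Sum>u\<in>V. S v u - T v u) = S v v - T v v"
      using fin v by simp
  qed
  finally have "complex_of_real (expectation (\<lambda>\<omega>. (cmod (\<Sum>v\<in>V. \<phi> v \<omega> * Y v \<omega>))\<^sup>2)
      - expectation (\<lambda>\<omega>. (cmod (\<Sum>v\<in>V. \<phi> v \<omega> * m v))\<^sup>2)) = (\<Sum>v\<in>V. S v v - T v v)"
    by (simp only: of_real_diff)
  from arg_cong[OF this, of Re]
  have "expectation (\<lambda>\<omega>. (cmod (\<Sum>v\<in>V. \<phi> v \<omega> * Y v \<omega>))\<^sup>2)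
      - expectation (\<lambda>\<omega>. (cmod (\<Sum>v\<in>V. \<phi> v \<omega> * m v))\<^sup>2) = Re (\<Sum>v\<in>V. S v v - T v v)"
    by (simp only: Re_complex_of_real)
  also have "\<dots> \<le> (\<Sum>v\<in>V. b\<^sup>2)"
    unfolding Re_sum by (intro sum_mono diag)
  finally show ?thesis by (simp add: mult.commute)
qed

text \<open>
  The form in which independence is used: \<open>J\<close> indexes the cuts made before the current level, and
  \<open>v\<close>, \<open>u\<close> are two sticks of that level.
\<close>
lemma expectation_prod_past_and_two:
  fixes a :: "('i \<Rightarrow> 'b) \<Rightarrow> complex" and p q :: "'b \<Rightarrow> complex"
  assumes indep: "indep_vars D Z V"
    and J: "J \<subseteq> V" and v: "v \<in> V" "v \<notin> J" and u: "u \<in> V" "u \<notin> J" and "v \<noteq> u"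
    and a: "a \<in> borel_measurable (PiM J D)" "\<And>f. cmod (a f) \<le> c"
    and p: "p \<in> borel_measurable (D v)" "\<And>z. cmod (p z) \<le> c"
    and q: "q \<in> borel_measurable (D u)" "\<And>z. cmod (q z) \<le> c"
  shows "expectation (\<lambda>\<omega>. a (restrict (\<lambda>i. Z i \<omega>) J) * (p (Z v \<omega>) * q (Z u \<omega>)))
    = expectation (\<lambda>\<omega>. a (restrict (\<lambda>i. Z i \<omega>) J))
      * (expectation (\<lambda>\<omega>. p (Z v \<omega>)) * expectation (\<lambda>\<omega>. q (Z u \<omega>)))"
proof -
  define B where "B i = (if i = 0 then J else if i = 1 then {v} else {u})" for i :: nat
  define g where "g i = (if i = 0 then a else if i = 1 then (\<lambda>f. p (f v)) else (\<lambda>f. q (f u)))"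
    for i :: nat
  have g: "g i \<in> borel_measurable (PiM (B i) D)" for i
    unfolding g_def B_def using a p q
    by (auto intro: measurable_compose[OF measurable_component_singleton])
  have "indep_vars (\<lambda>i. PiM (B i) D) (\<lambda>i \<omega>. restrict (\<lambda>i. Z i \<omega>) (B i)) {0, 1, 2}"
    using J v u \<open>v \<noteq> u\<close> by (intro indep_vars_restrict[OF indep])
      (auto simp: B_def disjoint_family_on_def)
  then have ind: "indep_vars (\<lambda>_. borel) (\<lambda>i \<omega>. g i (restrict (\<lambda>i. Z i \<omega>) (B i))) {0, 1, 2}"
    by (rule indep_vars_compose2) (rule g)
  have "integrable M (\<lambda>\<omega>. g i (restrict (\<lambda>i. Z i \<omega>) (B i)))" if "i \<in> {0, 1, 2}" for i
  proof (rule integrable_const_bound)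
    show "AE \<omega> in M. cmod (g i (restrict (\<lambda>i. Z i \<omega>) (B i))) \<le> c"
      using a p q by (simp add: g_def)
    show "(\<lambda>\<omega>. g i (restrict (\<lambda>i. Z i \<omega>) (B i))) \<in> borel_measurable M"
      using ind that unfolding indep_vars_def2 by blast
  qed
  from indep_vars_lebesgue_integral[OF _ ind this] show ?thesis
    by (simp add: g_def B_def)
qed

end

text \<open>
  The process with its random choices frozen: the level \<open>n\<close> breaks into \<open>\<kappa> n\<close> parts, the cuts \<open>Z v\<close> are
  independent, and part number \<open>j\<close> of the stick \<open>v\<close> multiplies its phase by \<open>y v j (Z v)\<close>.  Phases of
  parts of a stick that is really broken contract by a factor \<open>\<rho>\<close> in the mean.
\<close>
locale branching_phases = prob_space M for M :: "'a measure" +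
  fixes D :: "nat list \<Rightarrow> 'b measure" and Z :: "nat list \<Rightarrow> 'a \<Rightarrow> 'b" and V :: "nat list set"
    and \<kappa> :: "nat \<Rightarrow> nat" and N :: nat and y :: "nat list \<Rightarrow> nat \<Rightarrow> 'b \<Rightarrow> complex" and \<rho> :: real
  assumes indep: "indep_vars D Z V"
    and sticks_V: "n < N \<Longrightarrow> sticks \<kappa> n \<subseteq> V"
    and \<kappa>_pos: "n < N \<Longrightarrow> 0 < \<kappa> n"
    and y_measurable: "n < N \<Longrightarrow> v \<in> sticks \<kappa> n \<Longrightarrow> j < \<kappa> n \<Longrightarrow> y v j \<in> borel_measurable (D v)"
    and y_bounded: "cmod (y v j z) \<le> 1"
    and y_unbroken: "n < N \<Longrightarrow> v \<in> sticks \<kappa> n \<Longrightarrow> \<kappa> n = 1 \<Longrightarrow> y v 0 z = 1"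
    and y_contracts: "n < N \<Longrightarrow> v \<in> sticks \<kappa> n \<Longrightarrow> \<kappa> n \<noteq> 1 \<Longrightarrow> j < \<kappa> n \<Longrightarrow>
      cmod (expectation (\<lambda>\<omega>. y v j (Z v \<omega>))) \<le> \<rho>"
    and \<rho>: "0 < \<rho>" "\<rho> < 1"
begin

definition past :: "nat \<Rightarrow> nat list set" where
  "past n = {v \<in> V. length v < n}"

definition phase :: "nat list \<Rightarrow> 'a \<Rightarrow> complex" where
  "phase v \<omega> = path_prod (\<lambda>u j. y u j (Z u \<omega>)) v"

text \<open>
  The factor \<open>(1 + \<rho>\<^sup>2) / 2\<close> lies strictly above \<open>\<rho>\<^sup>2\<close>, the decay that the contraction of the means gives
  per breaking level.  It is at least \<open>1/2\<close>, so that it also bounds the factor by which a breaking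
  reduces the reciprocal of the number of sticks.
\<close>
definition decay :: "nat \<Rightarrow> real" where
  "decay n = (\<Prod>i<n. if \<kappa> i = 1 then 1 else (1 + \<rho>\<^sup>2) / 2)"

lemma path_prod_measurable:
  assumes "v \<in> sticks \<kappa> n" "n \<le> N" "past n \<subseteq> J"
  shows "(\<lambda>f. path_prod (\<lambda>u j. y u j (f u)) v) \<in> borel_measurable (PiM J D)"
  using assms
proof (induction n arbitrary: v)
  case (Suc n)
  then obtain j u where v: "v = j # u" and j: "j < \<kappa> n" and u: "u \<in> sticks \<kappa> n" by auto
  have "u \<in> J"
    using Suc.prems u sticks_V[of n] length_stick[OF u] by (auto simp: past_def)
  then have "(\<lambda>f. y u j (f u)) \<in> borel_measurable (PiM J D)"
    using Suc.prems u j
    by (intro measurable_compose[OF measurable_component_singleton] y_measurable[of n]) auto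
  moreover have "past n \<subseteq> J"
    using Suc.prems by (auto simp: past_def)
  ultimately show ?case
    using Suc.IH[OF u] Suc.prems by (simp add: v borel_measurable_times)
qed simp

lemma phase_eq_past:
  assumes v: "v \<in> sticks \<kappa> n" and n: "n \<le> N"
  shows "phase v \<omega> = path_prod (\<lambda>u j. y u j (restrict (\<lambda>i. Z i \<omega>) (past n) u)) v"
  unfolding phase_def
proof (rule path_prod_cong[OF v])
  fix k u j assume k: "k < n" and u: "u \<in> sticks \<kappa> k"
  then have "u \<in> past n"
    using sticks_V[of k] n length_stick[OF u] by (auto simp: past_def)
  then show "y u j (Z u \<omega>) = y u j (restrict (\<lambda>i. Z i \<omega>) (past n) u)" by simp
qed

lemma Z_measurable: "v \<in> V \<Longrightarrow> Z v \<in> measurable M (D v)"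
  using indep by (simp add: indep_vars_def2)

lemma y_Z_measurable:
  "n < N \<Longrightarrow> v \<in> sticks \<kappa> n \<Longrightarrow> j < \<kappa> n \<Longrightarrow> (\<lambda>\<omega>. y v j (Z v \<omega>)) \<in> borel_measurable M"
  using sticks_V by (intro measurable_compose[OF Z_measurable y_measurable]) auto

lemma phase_measurable:
  assumes "v \<in> sticks \<kappa> n" "n \<le> N"
  shows "phase v \<in> borel_measurable M"
  using assms
proof (induction n arbitrary: v)
  case 0
  then have "phase v = (\<lambda>_. 1)" by (auto simp: phase_def)
  then show ?case by simp
next
  case (Suc n)
  then obtain j u where v: "v = j # u" and j: "j < \<kappa> n" and u: "u \<in> sticks \<kappa> n" by auto
  have "phase v = (\<lambda>\<omega>. phase u \<omega> * y u j (Z u \<omega>))"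
    by (simp add: fun_eq_iff v phase_def)
  then show ?case
    using Suc.IH[OF u] y_Z_measurable[OF _ u j] Suc.prems by simp
qed

lemma norm_phase: "cmod (phase v \<omega>) \<le> 1"
  unfolding phase_def by (intro norm_path_prod_le_1 y_bounded)

lemma card_times_decay:
  assumes "n \<le> N"
  shows "1 \<le> card (sticks \<kappa> n) * decay n"
proof -
  have "(1::real) \<le> (\<Prod>i<n. real (\<kappa> i) * (if \<kappa> i = 1 then 1 else (1 + \<rho>\<^sup>2) / 2))"
  proof (rule prod_ge_1)
    fix i assume "i \<in> {..<n}"
    with \<kappa>_pos[of i] assms have "0 < \<kappa> i" by simp
    then consider "\<kappa> i = 1" | "2 \<le> real (\<kappa> i)" "\<kappa> i \<noteq> 1" by linarith
    then show "1 \<le> real (\<kappa> i) * (if \<kappa> i = 1 then 1 else (1 + \<rho>\<^sup>2) / 2)"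
    proof cases
      case 2
      have "2 * (1 / 2) \<le> real (\<kappa> i) * ((1 + \<rho>\<^sup>2) / 2)"
        using 2 by (intro mult_mono) auto
      with 2 show ?thesis by simp
    qed simp
  qed
  then show ?thesis by (simp add: card_sticks decay_def prod.distrib)
qed

text \<open>
  The statement is proved for all bounded weights at once because the induction changes them:
  conditionally on the past, the sum over the parts of \<open>v\<close> has a mean \<open>m v\<close> of norm at most \<open>k * \<rho>\<close>, and
  replacing it by this mean leaves a sum over the previous level with new weights \<open>m v / (k * \<rho>)\<close>.
  For the normalised moments this is \<open>b (Suc n) \<le> \<rho>\<^sup>2 * b n + 1 / card (sticks \<kappa> n)\<close>.
\<close>
proposition second_moment_phase_sum:
  assumes "n \<le> N" and "\<And>v. cmod (w v) \<le> 1"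
  shows "expectation (\<lambda>\<omega>. (cmod (\<Sum>v\<in>sticks \<kappa> n. w v * phase v \<omega>))\<^sup>2)
    \<le> 2 / (1 - \<rho>\<^sup>2) * decay n * (real (card (sticks \<kappa> n)))\<^sup>2"
  using assms
proof (induction n arbitrary: w)
  case 0
  have "\<rho>\<^sup>2 < 1" using \<rho> by (simp add: power_less_one_iff)
  have "(cmod (w []))\<^sup>2 \<le> 1"
    using 0(2)[of "[]"] by (simp add: power_le_one)
  also have "1 \<le> 2 / (1 - \<rho>\<^sup>2)"
    using \<open>\<rho>\<^sup>2 < 1\<close> by (simp add: field_simps)
  finally show ?case by (simp add: phase_def decay_def prob_space)
next
  case (Suc n)
  define c where "c = 2 / (1 - \<rho>\<^sup>2)"
  have "\<rho>\<^sup>2 < 1" using \<rho> by (simp add: power_less_one_iff)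
  \<comment> \<open>The constant \<open>c\<close> is the solution of this equation, which closes the recursion.\<close>
  then have c: "c * \<rho>\<^sup>2 + 1 = c * ((1 + \<rho>\<^sup>2) / 2)"
    by (simp add: c_def field_simps)
  have n: "n < N" using Suc.prems by simp
  define k where "k = \<kappa> n"
  have k: "0 < k" using \<kappa>_pos[OF n] by (simp add: k_def)
  define s where "s = real (card (sticks \<kappa> n))"
  define Y where "Y v z = (\<Sum>j<k. w (j # v) * y v j z)" for v z
  have sum_eq: "(\<Sum>v\<in>sticks \<kappa> (Suc n). w v * phase v \<omega>)
      = (\<Sum>v\<in>sticks \<kappa> n. phase v \<omega> * Y v (Z v \<omega>))" for \<omega>
    unfolding sum_sticks_Suc Y_def k_def sum_distrib_left
    by (intro sum.cong) (simp_all add: phase_def mult_ac)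
  have card_Suc: "real (card (sticks \<kappa> (Suc n))) = k * s"
    by (simp add: card_sticks_Suc k_def s_def del: sticks.simps)
  show ?case
  proof (cases "k = 1")
    case True
    have "expectation (\<lambda>\<omega>. (cmod (\<Sum>v\<in>sticks \<kappa> (Suc n). w v * phase v \<omega>))\<^sup>2)
        = expectation (\<lambda>\<omega>. (cmod (\<Sum>v\<in>sticks \<kappa> n. w (0 # v) * phase v \<omega>))\<^sup>2)"
      unfolding sum_eq Y_def using True y_unbroken[OF n]
      by (intro Bochner_Integration.integral_cong refl arg_cong[of _ _ "\<lambda>z. (cmod z)\<^sup>2"] sum.cong)
        (simp_all add: k_def)
    also have "\<dots> \<le> c * decay n * s\<^sup>2"
      unfolding c_def s_def by (rule Suc.IH) (use n Suc.prems in auto)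
    finally show ?thesis
      unfolding c_def[symmetric] card_Suc using True by (simp add: decay_def k_def)
  next
    case False
    define m where "m v = expectation (\<lambda>\<omega>. Y v (Z v \<omega>))" for v
    have V: "v \<in> V" if "v \<in> sticks \<kappa> n" for v
      using sticks_V[OF n] that by auto
    have Y_meas: "Y v \<in> borel_measurable (D v)" if "v \<in> sticks \<kappa> n" for v
      unfolding Y_def using y_measurable[OF n that]
      by (intro borel_measurable_sum borel_measurable_times) (auto simp: k_def)
    have norm_sum_le: "cmod (\<Sum>j<k. w (j # v) * t j) \<le> k * r" if "\<And>j. j < k \<Longrightarrow> cmod (t j) \<le> r"
      for v t and r :: real
    proof -
      have "cmod (\<Sum>j<k. w (j # v) * t j) \<le> (\<Sum>j<k. 1 * r)"
        using that mult_mono[OF Suc.prems(2) that] by (intro sum_norm_le) (simp add: norm_mult)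
      then show ?thesis by simp
    qed
    have Y_bound: "cmod (Y v z) \<le> k" for v z
      unfolding Y_def using norm_sum_le[of "\<lambda>j. y v j z" 1 v] y_bounded by simp
    have m_bound: "cmod (m v) \<le> k * \<rho>" if v: "v \<in> sticks \<kappa> n" for v
    proof -
      have "integrable M (\<lambda>\<omega>. y v j (Z v \<omega>))" if "j < k" for j
        using y_Z_measurable[OF n v, of j] that y_bounded
        by (intro integrable_const_bound[where B=1]) (auto simp: k_def)
      then have "m v = (\<Sum>j<k. w (j # v) * expectation (\<lambda>\<omega>. y v j (Z v \<omega>)))"
        unfolding m_def Y_def by (simp add: integral_sum)
      then show ?thesis
        using y_contracts[OF n v] False by (auto simp: k_def intro!: norm_sum_le[unfolded k_def])
    qed
    have "expectation (\<lambda>\<omega>. (cmod (\<Sum>v\<in>sticks \<kappa> (Suc n). w v * phase v \<omega>))\<^sup>2)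
        \<le> expectation (\<lambda>\<omega>. (cmod (\<Sum>v\<in>sticks \<kappa> n. phase v \<omega> * m v))\<^sup>2) + (real k)\<^sup>2 * s"
      unfolding sum_eq s_def
    proof (rule second_moment_replace_by_means)
      fix v u assume v: "v \<in> sticks \<kappa> n" and u: "u \<in> sticks \<kappa> n" and "v \<noteq> u"
      define \<Phi> where "\<Phi> v f = path_prod (\<lambda>u j. y u j (f u)) v" for v f
      have \<Phi>_meas: "\<Phi> v \<in> borel_measurable (PiM (past n) D)" if "v \<in> sticks \<kappa> n" for v
        unfolding \<Phi>_def using path_prod_measurable[OF that] n by simp
      have \<Phi>: "phase v \<omega> = \<Phi> v (restrict (\<lambda>i. Z i \<omega>) (past n))" if "v \<in> sticks \<kappa> n" for v \<omega>
        unfolding \<Phi>_def using phase_eq_past[OF that] n by simp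
      have \<Phi>_bound: "cmod (\<Phi> v f) \<le> 1" for v f
        unfolding \<Phi>_def by (intro norm_path_prod_le_1 y_bounded)
      have "cmod (\<Phi> v f * cnj (\<Phi> u f)) \<le> real k" for f
      proof -
        have "cmod (\<Phi> v f * cnj (\<Phi> u f)) \<le> 1"
          using \<Phi>_bound by (simp add: norm_mult mult_le_one)
        also have "1 \<le> real k" using k by simp
        finally show ?thesis .
      qed
      moreover have "(\<lambda>f. \<Phi> v f * cnj (\<Phi> u f)) \<in> borel_measurable (PiM (past n) D)"
        by (intro borel_measurable_times borel_measurable_cnj \<Phi>_meas u v)
      moreover have "v \<notin> past n" "u \<notin> past n" "past n \<subseteq> V"
        using length_stick[OF v] length_stick[OF u] by (auto simp: past_def)
      ultimately have "expectation (\<lambda>\<omega>. \<Phi> v (restrict (\<lambda>i. Z i \<omega>) (past n))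
            * cnj (\<Phi> u (restrict (\<lambda>i. Z i \<omega>) (past n))) * (Y v (Z v \<omega>) * cnj (Y u (Z u \<omega>))))
          = expectation (\<lambda>\<omega>. \<Phi> v (restrict (\<lambda>i. Z i \<omega>) (past n))
            * cnj (\<Phi> u (restrict (\<lambda>i. Z i \<omega>) (past n))))
            * (m v * expectation (\<lambda>\<omega>. cnj (Y u (Z u \<omega>))))"
        unfolding m_def
        using V[OF v] V[OF u] \<open>v \<noteq> u\<close> Y_bound Y_meas[OF v] borel_measurable_cnj[OF Y_meas[OF u]]
        by (intro expectation_prod_past_and_two[where a = "\<lambda>f. \<Phi> v f * cnj (\<Phi> u f)" and p = "Y v"
              and q = "\<lambda>z. cnj (Y u z)" and c = "real k" and v = v and u = u, OF indep]) simp_all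
      then show "expectation (\<lambda>\<omega>. phase v \<omega> * cnj (phase u \<omega>) * (Y v (Z v \<omega>) * cnj (Y u (Z u \<omega>))))
          = expectation (\<lambda>\<omega>. phase v \<omega> * cnj (phase u \<omega>)) * (m v * cnj (m u))"
        unfolding \<Phi>[OF v] \<Phi>[OF u] by (simp add: m_def)
    next
      fix v assume v: "v \<in> sticks \<kappa> n"
      show "(\<lambda>\<omega>. Y v (Z v \<omega>)) \<in> borel_measurable M"
        by (rule measurable_compose[OF Z_measurable[OF V[OF v]] Y_meas[OF v]])
      have "real k * \<rho> \<le> real k * 1"
        using \<rho> by (intro mult_left_mono) auto
      with m_bound[OF v] show "cmod (m v) \<le> real k" by simp
    qed (use n in \<open>auto intro: finite_sticks phase_measurable norm_phase Y_bound\<close>)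
    also have "expectation (\<lambda>\<omega>. (cmod (\<Sum>v\<in>sticks \<kappa> n. phase v \<omega> * m v))\<^sup>2)
        \<le> (k * \<rho>)\<^sup>2 * (c * decay n * s\<^sup>2)"
    proof -
      define w' where "w' v = (if v \<in> sticks \<kappa> n then m v / (k * \<rho>) else 0)" for v
      have k\<rho>: "0 < k * \<rho>" using k \<rho> by simp
      have "cmod (w' v) \<le> 1" for v
        using m_bound[of v] k\<rho> \<rho> by (auto simp: w'_def norm_divide norm_mult divide_le_eq)
      then have "expectation (\<lambda>\<omega>. (cmod (\<Sum>v\<in>sticks \<kappa> n. w' v * phase v \<omega>))\<^sup>2) \<le> c * decay n * s\<^sup>2"
        unfolding c_def s_def by (intro Suc.IH) (use n in auto)
      moreover have "(\<Sum>v\<in>sticks \<kappa> n. phase v \<omega> * m v)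
          = of_real (k * \<rho>) * (\<Sum>v\<in>sticks \<kappa> n. w' v * phase v \<omega>)" for \<omega>
        unfolding sum_distrib_left using k\<rho> by (intro sum.cong) (auto simp: w'_def)
      then have "(cmod (\<Sum>v\<in>sticks \<kappa> n. phase v \<omega> * m v))\<^sup>2
          = (k * \<rho>)\<^sup>2 * (cmod (\<Sum>v\<in>sticks \<kappa> n. w' v * phase v \<omega>))\<^sup>2" for \<omega>
        by (simp add: norm_mult power_mult_distrib)
      ultimately show ?thesis
        by (simp add: mult_left_mono)
    qed
    also have "(k * \<rho>)\<^sup>2 * (c * decay n * s\<^sup>2) + (real k)\<^sup>2 * s
        \<le> (k * \<rho>)\<^sup>2 * (c * decay n * s\<^sup>2) + (real k)\<^sup>2 * (s * (s * decay n))"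
    proof -
      have "s * 1 \<le> s * (s * decay n)"
        using card_times_decay[of n] n by (intro mult_left_mono) (auto simp: s_def)
      then show ?thesis by (simp add: mult_left_mono)
    qed
    also have "\<dots> = (c * \<rho>\<^sup>2 + 1) * decay n * (k * s)\<^sup>2"
      by (simp add: power2_eq_square algebra_simps)
    also have "\<dots> = c * decay (Suc n) * (k * s)\<^sup>2"
      unfolding c using False by (simp add: decay_def k_def)
    finally show ?thesis
      unfolding c_def[symmetric] card_Suc by simp
  qed
qed

end

section \<open>Phases of gaps\<close>

lemma countable_cis_fibre:
  assumes "\<theta> \<noteq> 0"
  shows "countable {r. cis (\<theta> * r) = z}"
proof (cases "{r. cis (\<theta> * r) = z} = {}")
  case False
  then obtain s where s: "cis (\<theta> * s) = z" by auto
  have "{r. cis (\<theta> * r) = z} \<subseteq> range (\<lambda>n::int. (\<theta> * s + 2 * pi * n) / \<theta>)"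
  proof
    fix r assume "r \<in> {r. cis (\<theta> * r) = z}"
    with s have "cis (\<theta> * r) = cis (\<theta> * s)" by simp
    then obtain n :: int where "\<theta> * r = \<theta> * s + 2 * pi * n"
      using sin_cos_eq_iff[of "\<theta> * r" "\<theta> * s"] by (auto simp: cis.ctr)
    then show "r \<in> range (\<lambda>n::int. (\<theta> * s + 2 * pi * n) / \<theta>)"
      using assms by (auto simp: field_simps)
  qed
  then show ?thesis by (rule countable_subset) simp
qed (metis countable_empty)

text \<open>
  Equality in the triangle inequality: if the mean \<open>z\<close> of \<open>U\<close> has norm 1, then \<open>(cmod (U - z))\<^sup>2\<close> has
  mean \<open>2 - 2 * Re (z * cnj z) = 0\<close>.
\<close>
lemma (in prob_space) AE_eq_expectation_if_norm_1:
  fixes U :: "'a \<Rightarrow> complex"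
  assumes [measurable]: "U \<in> borel_measurable M" and U: "\<And>\<omega>. cmod (U \<omega>) = 1"
    and "cmod (expectation U) = 1"
  shows "AE \<omega> in M. U \<omega> = expectation U"
proof -
  define z where "z = expectation U"
  have U_int: "integrable M U"
    by (rule integrable_const_bound[where B = 1]) (auto simp: U)
  have sq: "(cmod (U \<omega> - z))\<^sup>2 = 2 - 2 * Re (U \<omega> * cnj z)" for \<omega>
  proof -
    have "(cmod (U \<omega> - z))\<^sup>2 = (cmod (U \<omega>))\<^sup>2 + (cmod z)\<^sup>2 - 2 * Re (U \<omega> * cnj z)"
      unfolding cmod_power2 by (simp add: power2_eq_square algebra_simps)
    then show ?thesis using U assms(3) by (simp add: z_def)
  qed
  have int: "integrable M (\<lambda>\<omega>. Re (U \<omega> * cnj z))"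
    using U_int by (intro integrable_Re integrable_mult_left) auto
  then have int_sq: "integrable M (\<lambda>\<omega>. (cmod (U \<omega> - z))\<^sup>2)"
    unfolding sq by (intro Bochner_Integration.integrable_diff integrable_mult_right integrable_const int)
  have "expectation (\<lambda>\<omega>. Re (U \<omega> * cnj z)) = Re (z * cnj z)"
    using U_int by (simp add: integral_Re integrable_mult_left z_def del: complex_cnj_cnj times_complex.sel)
  also have "\<dots> = 1"
    using assms(3) by (simp only: complex_norm_square[symmetric] z_def Re_complex_of_real) simp
  finally have "expectation (\<lambda>\<omega>. (cmod (U \<omega> - z))\<^sup>2) = 0"
    unfolding sq using int by (simp add: prob_space del: times_complex.sel)
  then have "AE \<omega> in M. (cmod (U \<omega> - z))\<^sup>2 = 0"
    using integral_nonneg_eq_0_iff_AE[OF int_sq] by simp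
  then show ?thesis unfolding z_def by simp
qed

text \<open>
  If the norm were 1, the phase would be constant almost surely, so \<open>ln Y\<close> would lie in a translate of
  a lattice; but a countable set is null for a variable with a density.
\<close>
lemma (in prob_space) norm_expectation_phase_less_1:
  assumes Y: "distributed M lborel Y f" and pos: "AE \<omega> in M. 0 < Y \<omega>" and \<theta>: "\<theta> \<noteq> 0"
  shows "cmod (expectation (\<lambda>\<omega>. cis (\<theta> * ln (Y \<omega>)))) < 1"
proof (rule ccontr)
  let ?U = "\<lambda>\<omega>. cis (\<theta> * ln (Y \<omega>))"
  have [measurable]: "Y \<in> borel_measurable M"
    using distributed_measurable[OF Y] by simp
  have meas: "?U \<in> borel_measurable M"
    unfolding cis_conv_exp by measurable
  assume "\<not> cmod (expectation ?U) < 1"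
  moreover have "cmod (expectation ?U) \<le> 1"
    using integral_norm_bound[of M ?U] by (simp add: prob_space)
  ultimately have "AE \<omega> in M. ?U \<omega> = expectation ?U"
    by (intro AE_eq_expectation_if_norm_1 meas) auto
  then have const: "AE \<omega> in M. ?U \<omega> = expectation ?U" .
  define S where "S = exp ` {r. cis (\<theta> * r) = expectation ?U}"
  from const pos have "AE \<omega> in M. Y \<omega> \<in> S"
  proof eventually_elim
    case (elim \<omega>)
    then show ?case unfolding S_def by (intro image_eqI[of _ _ "ln (Y \<omega>)"]) auto
  qed
  moreover have "AE \<omega> in M. Y \<omega> \<notin> S"
  proof -
    have "countable S"
      unfolding S_def by (intro countable_image countable_cis_fibre \<theta>)
    then have S: "S \<in> null_sets lborel"
      by (rule countable_imp_null_set_lborel)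
    then have [measurable]: "S \<in> sets borel" by auto
    have "AE t in lborel. 0 < f t \<longrightarrow> t \<notin> S"
      using AE_not_in[OF S] by auto
    then show ?thesis
      by (subst distributed_AE2[OF Y]) auto
  qed
  ultimately have "AE \<omega> in M. False" by eventually_elim simp
  then show False by simp
qed

lemma gap_unbroken: "gap 0 x 0 = 1"
  by (simp add: gap_def rk_def)

text \<open>
  The density carries the factor \<^term>\<open>indicator {0..1}\<close>; together with the absence of
  atoms this gives the positivity of the gaps without any analysis of the sorted cut points.
\<close>
lemma good_distribution_gap:
  assumes D: "good_distribution (k - 1) D" and j: "j < k"
  shows "(\<lambda>x. gap (k - 1) x j) \<in> borel_measurable D" (is ?meas)
    and "AE x in D. 0 < gap (k - 1) x j" (is ?pos)
    and "k \<noteq> 1 \<Longrightarrow> \<theta> \<noteq> 0 \<Longrightarrow> cmod (\<integral>x. cis (\<theta> * ln (gap (k - 1) x j)) \<partial>D) < 1"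
proof -
  interpret D: prob_space D using D by (simp add: good_distribution_def)
  have density: "\<exists>f. distributed D lborel (\<lambda>x. gap (k - 1) x j) (\<lambda>t. ennreal (f t * indicator {0..1} t))"
    if "k \<noteq> 1"
  proof -
    have "0 < k - 1" "j \<le> k - 1" using that j by auto
    then show ?thesis using D by (auto simp: good_distribution_def has_holder_density_def)
  qed
  have meas_pos: "?meas \<and> ?pos"
  proof (cases "k = 1")
    case True
    with j show ?thesis by (simp add: gap_unbroken)
  next
    case False
    from density[OF this] obtain f
      where f: "distributed D lborel (\<lambda>x. gap (k - 1) x j) (\<lambda>t. ennreal (f t * indicator {0..1} t))" ..
    have "{0::real} \<in> null_sets lborel"
      by (rule countable_imp_null_set_lborel) simp
    then have "AE t::real in lborel. t \<noteq> 0"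
      using AE_not_in by fastforce
    then have "AE t in lborel. 0 < ennreal (f t * indicator {0..1} t) \<longrightarrow> 0 < t"
      by eventually_elim (auto simp: indicator_def split: if_splits)
    then have ?pos by (subst D.distributed_AE2[OF f]) auto
    then show ?thesis using distributed_measurable[OF f] by simp
  qed
  then show ?meas ?pos by auto
  assume "k \<noteq> 1" "\<theta> \<noteq> 0"
  with density obtain f
    where "distributed D lborel (\<lambda>x. gap (k - 1) x j) (\<lambda>t. ennreal (f t * indicator {0..1} t))"
    by auto
  then show "cmod (\<integral>x. cis (\<theta> * ln (gap (k - 1) x j)) \<partial>D) < 1"
    using meas_pos \<open>\<theta> \<noteq> 0\<close> by (intro D.norm_expectation_phase_less_1) auto
qed

section \<open>Independence and almost sure convergence\<close>

context prob_space begin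

lemma indep_vars_reindex:
  assumes indep: "indep_vars D X I" and f: "inj_on f V" "f ` V \<subseteq> I"
  shows "indep_vars (\<lambda>v. D (f v)) (\<lambda>v. X (f v)) V"
  unfolding indep_vars_def2
proof (intro conjI ballI)
  fix v assume "v \<in> V"
  with f indep show "random_variable (D (f v)) (X (f v))"
    by (auto simp: indep_vars_def2)
next
  let ?F = "\<lambda>i. {X i -` A \<inter> space M |A. A \<in> sets (D i)}"
  have F: "indep_sets ?F I" using indep by (simp add: indep_vars_def2)
  show "indep_sets (\<lambda>v. ?F (f v)) V"
  proof (rule indep_setsI)
    fix v assume "v \<in> V"
    with f have "f v \<in> I" by auto
    with F show "?F (f v) \<subseteq> events" unfolding indep_sets_def by blast
  next
    fix A J assume J: "J \<noteq> {}" "J \<subseteq> V" "finite J" and A: "\<forall>j\<in>J. A j \<in> ?F (f j)"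
    have inj: "inj_on f J" using f J inj_on_subset by blast
    let ?A = "\<lambda>i. A (the_inv_into J f i)"
    have "prob (\<Inter>i\<in>f ` J. ?A i) = (\<Prod>i\<in>f ` J. prob (?A i))"
    proof (rule indep_setsD[OF F])
      show "f ` J \<subseteq> I" using f J by blast
      show "\<forall>i\<in>f ` J. ?A i \<in> ?F i"
        using A by (auto simp del: mem_Collect_eq simp: the_inv_into_f_f[OF inj])
    qed (use J in auto)
    then show "prob (\<Inter>j\<in>J. A j) = (\<Prod>j\<in>J. prob (A j))"
      by (simp add: prod.reindex[OF inj] the_inv_into_f_f[OF inj])
  qed
qed

text \<open>
  Independence of two \<open>\<sigma>\<close>-algebras in the form of a conditional expectation: on an event from the first
  one, a variable measurable for the second one has its unconditional mean.
\<close>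
lemma expectation_indicator_times_indep:
  fixes W :: "'a \<Rightarrow> real"
  assumes indep: "indep_set (sets A) (sets B)" and space: "space A = space M" "space B = space M"
    and E: "E \<in> sets A" and W: "W \<in> borel_measurable B" and int: "integrable M W"
  shows "expectation (\<lambda>\<omega>. indicator E \<omega> * W \<omega>) = prob E * expectation W"
proof -
  have events: "sets A \<subseteq> events" "sets B \<subseteq> events"
    using indep by (auto simp: indep_sets2_eq)
  have "{indicator E -` S \<inter> space M |S. S \<in> sets (borel :: real measure)} \<subseteq> sets A"
    using measurable_sets[of "indicator E :: 'a \<Rightarrow> real" A borel] E by (auto simp: space)
  then have A: "sigma_sets (space M) {indicator E -` S \<inter> space M |S. S \<in> sets (borel :: real measure)} \<subseteq> sets A"
    using sets.sigma_sets_subset[of _ A] by (simp add: space)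
  have "{W -` S \<inter> space M |S. S \<in> sets (borel :: real measure)} \<subseteq> sets B"
    using measurable_sets[OF W] by (auto simp: space)
  then have B: "sigma_sets (space M) {W -` S \<inter> space M |S. S \<in> sets (borel :: real measure)} \<subseteq> sets B"
    using sets.sigma_sets_subset[of _ B] by (simp add: space)
  have E_meas: "E \<in> events" using E events by auto
  have "indep_var borel (indicator E :: 'a \<Rightarrow> real) borel W"
    unfolding indep_var_eq
  proof (intro conjI)
    show "indep_set (sigma_sets (space M) {indicator E -` S \<inter> space M |S. S \<in> sets (borel :: real measure)})
        (sigma_sets (space M) {W -` S \<inter> space M |S. S \<in> sets (borel :: real measure)})"
    proof (rule indep_setI)
      fix a b
      assume "a \<in> sigma_sets (space M) {indicator E -` S \<inter> space M |S. S \<in> sets (borel :: real measure)}"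
        and "b \<in> sigma_sets (space M) {W -` S \<inter> space M |S. S \<in> sets (borel :: real measure)}"
      with A B show "prob (a \<inter> b) = prob a * prob b"
        by (intro indep_setD[OF indep]) auto
    qed (rule order_trans[OF A events(1)] order_trans[OF B events(2)])+
  qed (use E_meas int in auto)
  then have "expectation (\<lambda>\<omega>. indicator E \<omega> * W \<omega>) = expectation (indicator E) * expectation W"
    using int E_meas by (intro indep_var_lebesgue_integral integrable_const_bound[of "indicator E" 1]) auto
  then show ?thesis using E_meas by simp
qed

lemma AE_tendsto_0_of_summable_expectations:
  fixes T :: "nat \<Rightarrow> 'a \<Rightarrow> real"
  assumes int: "\<And>n. integrable M (T n)" and nonneg: "\<And>n \<omega>. 0 \<le> T n \<omega>"
    and sum: "summable (\<lambda>n. expectation (T n))"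
  shows "AE \<omega> in M. (\<lambda>n. T n \<omega>) \<longlonglongrightarrow> 0"
proof -
  have "(\<integral>\<^sup>+\<omega>. (\<Sum>n. ennreal (T n \<omega>)) \<partial>M) = (\<Sum>n. \<integral>\<^sup>+\<omega>. ennreal (T n \<omega>) \<partial>M)"
    using int by (intro nn_integral_suminf) auto
  also have "\<dots> = (\<Sum>n. ennreal (expectation (T n)))"
    using int nonneg by (intro suminf_cong nn_integral_eq_integral) auto
  also have "\<dots> = ennreal (\<Sum>n. expectation (T n))"
    using nonneg sum by (intro suminf_ennreal2) auto
  finally have "(\<integral>\<^sup>+\<omega>. (\<Sum>n. ennreal (T n \<omega>)) \<partial>M) \<noteq> \<infinity>" by simp
  then have "AE \<omega> in M. (\<Sum>n. ennreal (T n \<omega>)) \<noteq> \<infinity>"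
    using int by (intro nn_integral_PInf_AE) auto
  then show ?thesis
  proof eventually_elim
    case (elim \<omega>)
    then have "summable (\<lambda>n. T n \<omega>)"
      using nonneg by (intro summable_suminf_not_top) auto
    then show ?case by (rule summable_LIMSEQ_zero)
  qed
qed

end

section \<open>The breaking process\<close>

lemma sticks_cong: "(\<And>i. i < n \<Longrightarrow> \<kappa> i = \<kappa>' i) \<Longrightarrow> sticks \<kappa> n = sticks \<kappa>' n"
  by (induction n) auto

lemma set_stick_subset:
  "v \<in> sticks \<kappa> n \<Longrightarrow> (\<And>i. i < n \<Longrightarrow> \<kappa> i \<le> m) \<Longrightarrow> set v \<subseteq> {..<m}"
proof (induction n arbitrary: v)
  case (Suc n)
  then obtain j u where v: "v = j # u" and j: "j < \<kappa> n" and u: "u \<in> sticks \<kappa> n" by auto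
  have "j < m" using j Suc.prems(2)[OF lessI] by simp
  moreover have "set u \<subseteq> {..<m}"
    using Suc.prems(2) by (intro Suc.IH[OF u]) simp
  ultimately show ?case by (simp add: v)
qed simp

lemma sticks_nonempty: "(\<And>i. i < n \<Longrightarrow> 0 < \<kappa> i) \<Longrightarrow> sticks \<kappa> n \<noteq> {}"
  by (induction n) (auto simp: less_Suc_eq)

definition gap_phase :: "(nat \<Rightarrow> nat) \<Rightarrow> real \<Rightarrow> nat list \<Rightarrow> nat \<Rightarrow> (nat \<Rightarrow> real) \<Rightarrow> complex" where
  "gap_phase \<kappa> \<theta> v j z = cis (\<theta> * ln (gap (\<kappa> (length v) - 1) z j))"

text \<open>
  Up to the factor \<open>cis (\<theta> * ln L)\<close>, the normalised exponential sum over the stick lengths at level \<open>n\<close>.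
  It is built from products of phases instead of lengths because these are multiplicative everywhere,
  not only when all gaps are positive.
\<close>
definition mean_phase :: "(nat \<Rightarrow> nat) \<Rightarrow> (nat list \<Rightarrow> nat \<Rightarrow> real) \<Rightarrow> real \<Rightarrow> nat \<Rightarrow> complex" where
  "mean_phase \<kappa> x \<theta> n =
     (\<Sum>v\<in>sticks \<kappa> n. path_prod (\<lambda>u j. gap_phase \<kappa> \<theta> u j (x u)) v) / of_nat (card (sticks \<kappa> n))"

lemma cis_ln_stick_length:
  assumes L: "0 < L" and v: "v \<in> sticks \<kappa> n"
    and pos: "\<And>k u j. k < n \<Longrightarrow> u \<in> sticks \<kappa> k \<Longrightarrow> j < \<kappa> k \<Longrightarrow> 0 < gap (\<kappa> k - 1) (x u) j"
  shows "0 < stick_length \<kappa> x L v \<and> cis (\<theta> * ln (stick_length \<kappa> x L v))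
    = cis (\<theta> * ln L) * path_prod (\<lambda>u j. gap_phase \<kappa> \<theta> u j (x u)) v"
  using v pos
proof (induction n arbitrary: v)
  case 0
  with L show ?case by simp
next
  case (Suc n)
  then obtain j u where v: "v = j # u" and j: "j < \<kappa> n" and u: "u \<in> sticks \<kappa> n" by auto
  have "0 < gap (\<kappa> n - 1) (x u) j"
    using Suc.prems(2)[OF lessI u j] .
  moreover have "0 < stick_length \<kappa> x L u \<and> cis (\<theta> * ln (stick_length \<kappa> x L u))
      = cis (\<theta> * ln L) * path_prod (\<lambda>u j. gap_phase \<kappa> \<theta> u j (x u)) u"
    using Suc.prems(2) less_Suc_eq by (intro Suc.IH[OF u]) blast
  ultimately show ?case
    using length_stick[OF u]
    by (simp add: v gap_phase_def ln_mult_pos distrib_left mult.assoc flip: cis_mult)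
qed

lemma mean_phase_cong:
  assumes \<kappa>: "\<And>i. i < n \<Longrightarrow> \<kappa> i = \<kappa>' i"
    and x: "\<And>k u. k < n \<Longrightarrow> u \<in> sticks \<kappa> k \<Longrightarrow> x u = x' u"
  shows "mean_phase \<kappa> x \<theta> n = mean_phase \<kappa>' x' \<theta> n"
proof -
  have sticks: "sticks \<kappa>' n = sticks \<kappa> n"
    using \<kappa> by (intro sticks_cong) simp
  have "path_prod (\<lambda>u j. gap_phase \<kappa> \<theta> u j (x u)) v = path_prod (\<lambda>u j. gap_phase \<kappa>' \<theta> u j (x' u)) v"
    if "v \<in> sticks \<kappa> n" for v
    using \<kappa> x by (intro path_prod_cong[OF that]) (simp add: gap_phase_def length_stick)
  then show ?thesis
    unfolding mean_phase_def sticks by simp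
qed

lemma norm_mean_phase_le_1: "cmod (mean_phase \<kappa> x \<theta> n) \<le> 1"
proof -
  have "cmod (\<Sum>v\<in>sticks \<kappa> n. path_prod (\<lambda>u j. gap_phase \<kappa> \<theta> u j (x u)) v) \<le> (\<Sum>v\<in>sticks \<kappa> n. 1)"
    by (intro sum_norm_le norm_path_prod_le_1) (simp add: gap_phase_def)
  then show ?thesis
    by (auto simp: mean_phase_def norm_divide divide_le_eq)
qed

locale stick_breaking =
  fixes m :: nat and G :: "nat pmf" and F :: "nat \<Rightarrow> (nat \<Rightarrow> real) measure set"
    and M :: "'a measure" and K :: "nat \<Rightarrow> 'a \<Rightarrow> nat"
    and C :: "nat list \<Rightarrow> 'a \<Rightarrow> (nat \<Rightarrow> real) measure"
    and X :: "nat list \<Rightarrow> (nat \<Rightarrow> real) measure \<Rightarrow> 'a \<Rightarrow> nat \<Rightarrow> real"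
  assumes G_range: "set_pmf G \<subseteq> {1..m}" and G_breaks: "pmf G 1 < 1"
    and F_finite: "k \<in> {1..m} \<Longrightarrow> finite (F k)"
    and F_good: "k \<in> {1..m} \<Longrightarrow> D \<in> F k \<Longrightarrow> good_distribution (k - 1) D"
    and process: "breaking_process M G F K C X"
begin

abbreviation I :: "(nat list \<times> (nat \<Rightarrow> real) measure) set" where
  "I \<equiv> UNIV \<times> (\<Union>k\<in>set_pmf G. F k)"

text \<open>
  The two independent \<open>\<sigma>\<close>-algebras of the process: the information contained in the choices \<open>K\<close>, \<open>C\<close>, and
  that contained in the supply of samples \<open>X\<close>.
\<close>
definition choice_algebra :: "'a measure" where
  "choice_algebra = vimage_algebra (space M) (\<lambda>\<omega>. (\<lambda>n. K n \<omega>, \<lambda>v. C v \<omega>))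
     (Pi\<^sub>M UNIV (\<lambda>_. count_space UNIV) \<Otimes>\<^sub>M Pi\<^sub>M UNIV (\<lambda>_. count_space UNIV))"

definition cut_algebra :: "'a measure" where
  "cut_algebra = vimage_algebra (space M) (\<lambda>\<omega>. \<lambda>(v, D)\<in>I. X v D \<omega>) (Pi\<^sub>M I (\<lambda>(v, D). D))"

sublocale prob_space M
  using process by (simp add: breaking_process_def Let_def)

lemma K_indep: "indep_vars (\<lambda>_. count_space UNIV) K UNIV"
  and K_distr: "distr M (count_space UNIV) (K n) = measure_pmf G"
  and C_family: "AE \<omega> in M. C v \<omega> \<in> F (K (length v) \<omega>)"
  and X_measurable: "(v, D) \<in> I \<Longrightarrow> X v D \<in> measurable M D"
  and X_distr: "(v, D) \<in> I \<Longrightarrow> distr M D (X v D) = D"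
  and X_indep: "indep_vars (\<lambda>(v, D). D) (\<lambda>(v, D). X v D) I"
  and choices_cuts_indep: "indep_set (sets choice_algebra) (sets cut_algebra)"
  using process unfolding breaking_process_def Let_def choice_algebra_def cut_algebra_def
  by blast+

lemma K_measurable [measurable]: "K n \<in> measurable M (count_space UNIV)"
  using K_indep by (simp add: indep_vars_def2)

lemma space_algebras: "space choice_algebra = space M" "space cut_algebra = space M"
  by (simp_all add: choice_algebra_def cut_algebra_def)

lemma K_choice: "K n \<in> measurable choice_algebra (count_space UNIV)"
  and C_choice: "C v \<in> measurable choice_algebra (count_space UNIV)"
proof -
  have *: "(\<lambda>\<omega>. (\<lambda>n. K n \<omega>, \<lambda>v. C v \<omega>)) \<in> measurable choice_algebra
      (Pi\<^sub>M UNIV (\<lambda>_. count_space UNIV) \<Otimes>\<^sub>M Pi\<^sub>M UNIV (\<lambda>_. count_space UNIV))"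
    unfolding choice_algebra_def
    by (rule measurable_vimage_algebra1) (auto simp: space_pair_measure space_PiM)
  from measurable_compose[OF measurable_compose[OF * measurable_fst] measurable_component_singleton[of n]]
  show "K n \<in> measurable choice_algebra (count_space UNIV)" by simp
  from measurable_compose[OF measurable_compose[OF * measurable_snd] measurable_component_singleton[of v]]
  show "C v \<in> measurable choice_algebra (count_space UNIV)" by simp
qed

lemma X_cut:
  assumes "(v, D) \<in> I"
  shows "X v D \<in> measurable cut_algebra D"
proof -
  have "(\<lambda>\<omega>. \<lambda>(v, D)\<in>I. X v D \<omega>) \<in> space M \<rightarrow> space (Pi\<^sub>M I (\<lambda>(v, D). D))"
    using measurable_space[OF X_measurable]
    by (intro funcsetI) (auto simp: space_PiM simp del: mem_Sigma_iff UN_iff)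
  then have "(\<lambda>\<omega>. \<lambda>(v, D)\<in>I. X v D \<omega>) \<in> measurable cut_algebra (Pi\<^sub>M I (\<lambda>(v, D). D))"
    unfolding cut_algebra_def by (rule measurable_vimage_algebra1)
  from measurable_compose[OF this measurable_component_singleton[OF assms]] assms
  show ?thesis by simp
qed

lemma AE_K: "AE \<omega> in M. \<forall>n. K n \<omega> \<in> set_pmf G"
proof -
  have "AE \<omega> in M. K n \<omega> \<in> set_pmf G" for n
  proof (rule AE_distrD[OF K_measurable])
    show "AE k in distr M (count_space UNIV) (K n). k \<in> set_pmf G"
      unfolding K_distr by (rule AE_pmfI)
  qed
  then show ?thesis by (simp add: AE_all_countable)
qed

lemma AE_C: "AE \<omega> in M. \<forall>v. C v \<omega> \<in> F (K (length v) \<omega>)"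
  using C_family by (simp add: AE_all_countable)

lemma AE_gaps_positive:
  "AE \<omega> in M. \<forall>v. \<forall>k\<in>set_pmf G. \<forall>D\<in>F k. \<forall>j<k. 0 < gap (k - 1) (X v D \<omega>) j"
proof -
  have "AE \<omega> in M. 0 < gap (k - 1) (X v D \<omega>) j"
    if "k \<in> set_pmf G" "D \<in> F k" "j < k" for v k D j
  proof -
    have I: "(v, D) \<in> I" using that by auto
    have "good_distribution (k - 1) D"
      using F_good that G_range by blast
    from good_distribution_gap(2)[OF this that(3)]
    have "AE x in distr M D (X v D). 0 < gap (k - 1) x j"
      unfolding X_distr[OF I] .
    then show ?thesis by (rule AE_distrD[OF X_measurable[OF I]])
  qed
  moreover have "finite (F k)" if "k \<in> set_pmf G" for k
    using F_finite G_range that by blast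
  moreover have "countable (set_pmf G)" by simp
  ultimately show ?thesis
    by (simp add: AE_all_countable AE_ball_countable AE_finite_all countable_finite)
qed

lemma AE_stick_lengths:
  assumes "0 < L"
  shows "AE \<omega> in M. \<forall>\<theta> n. \<forall>v\<in>sticks (\<lambda>n. K n \<omega>) n.
    0 < stick_length (\<lambda>n. K n \<omega>) (\<lambda>v. X v (C v \<omega>) \<omega>) L v \<and>
    cis (\<theta> * ln (stick_length (\<lambda>n. K n \<omega>) (\<lambda>v. X v (C v \<omega>) \<omega>) L v))
    = cis (\<theta> * ln L) * path_prod (\<lambda>u j. gap_phase (\<lambda>n. K n \<omega>) \<theta> u j (X u (C u \<omega>) \<omega>)) v"
  using AE_K AE_C AE_gaps_positive
proof eventually_elim
  case (elim \<omega>)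
  have "0 < gap (K k \<omega> - 1) (X u (C u \<omega>) \<omega>) j"
    if u: "u \<in> sticks (\<lambda>n. K n \<omega>) k" and j: "j < K k \<omega>" for k u j
    using elim length_stick[OF u] j by metis
  then show ?case
    using assms by (intro allI ballI cis_ln_stick_length) auto
qed

text \<open>
  A common bound for all phases of all distributions that can occur at a breaking level; the families
  being finite, it stays below 1.  The entry \<open>1/2\<close> keeps it positive.
\<close>
definition contraction :: "real \<Rightarrow> real" where
  "contraction \<theta> = Max (insert (1/2)
     ((\<lambda>(k, D, j). cmod (\<integral>x. cis (\<theta> * ln (gap (k - 1) x j)) \<partial>D)) `
       (SIGMA k:set_pmf G - {1}. F k \<times> {..<k})))"

lemma contraction:
  assumes "\<theta> \<noteq> 0"
  shows "0 < contraction \<theta>" "contraction \<theta> < 1"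
    and "k \<in> set_pmf G \<Longrightarrow> k \<noteq> 1 \<Longrightarrow> D \<in> F k \<Longrightarrow> j < k \<Longrightarrow>
      cmod (\<integral>x. cis (\<theta> * ln (gap (k - 1) x j)) \<partial>D) \<le> contraction \<theta>"
proof -
  let ?S = "SIGMA k:set_pmf G - {1}. F k \<times> {..<k}"
  let ?f = "\<lambda>(k, D, j). cmod (\<integral>x. cis (\<theta> * ln (gap (k - 1) x j)) \<partial>D)"
  have "finite (set_pmf G)" using G_range finite_subset by blast
  then have fin: "finite (insert (1/2) (?f ` ?S))"
    using F_finite G_range by (intro finite.insertI finite_imageI finite_SigmaI) auto
  show "0 < contraction \<theta>"
    unfolding contraction_def by (rule less_le_trans[OF _ Max_ge[OF fin, of "1/2"]]) auto
  show "contraction \<theta> < 1"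
  proof -
    have "?f s < 1" if "s \<in> ?S" for s
    proof -
      from that obtain k D j
        where s: "s = (k, D, j)" "k \<in> set_pmf G" "k \<noteq> 1" "D \<in> F k" "j < k" by auto
      then show ?thesis
        using assms F_good[of k D] G_range good_distribution_gap(3)[of k D j \<theta>] by auto
    qed
    then show ?thesis
      unfolding contraction_def by (subst Max_less_iff[OF fin]) auto
  qed
  assume "k \<in> set_pmf G" "k \<noteq> 1" "D \<in> F k" "j < k"
  then show "cmod (\<integral>x. cis (\<theta> * ln (gap (k - 1) x j)) \<partial>D) \<le> contraction \<theta>"
    unfolding contraction_def by (intro Max_ge[OF fin]) force
qed

definition addresses :: "nat \<Rightarrow> nat list set" where
  "addresses n = {v. set v \<subseteq> {..<m} \<and> length v < n}"

text \<open>
  Before level \<open>n\<close> only finitely many combinations of choices have positive probability.  Summing over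
  them replaces conditioning on the choices.
\<close>
definition scenarios :: "nat \<Rightarrow> ((nat \<Rightarrow> nat) \<times> (nat list \<Rightarrow> (nat \<Rightarrow> real) measure)) set" where
  "scenarios n = (SIGMA \<kappa>:(PiE {..<n} (\<lambda>_. set_pmf G)). PiE (addresses n) (\<lambda>v. F (\<kappa> (length v))))"

definition scenario :: "nat \<Rightarrow> 'a \<Rightarrow> (nat \<Rightarrow> nat) \<times> (nat list \<Rightarrow> (nat \<Rightarrow> real) measure)" where
  "scenario n \<omega> = (restrict (\<lambda>i. K i \<omega>) {..<n}, restrict (\<lambda>v. C v \<omega>) (addresses n))"

lemma finite_addresses: "finite (addresses n)"
  by (rule finite_subset[OF _ finite_lists_length_le[of "{..<m}" n]]) (auto simp: addresses_def)

lemma finite_scenarios: "finite (scenarios n)"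
  unfolding scenarios_def
proof (rule finite_SigmaI)
  have G: "finite (set_pmf G)" using G_range finite_subset by blast
  then show "finite (PiE {..<n} (\<lambda>_. set_pmf G))"
    by (intro finite_PiE) auto
  fix \<kappa> assume "\<kappa> \<in> PiE {..<n} (\<lambda>_. set_pmf G)"
  then have "finite (F (\<kappa> (length v)))" if "v \<in> addresses n" for v
    using that F_finite G_range by (auto simp: addresses_def PiE_iff subset_iff)
  then show "finite (PiE (addresses n) (\<lambda>v. F (\<kappa> (length v))))"
    by (intro finite_PiE finite_addresses)
qed

lemma AE_scenario: "AE \<omega> in M. \<forall>n. scenario n \<omega> \<in> scenarios n"
  using AE_K AE_C
proof eventually_elim
  case (elim \<omega>)
  then show ?case by (auto simp: scenario_def scenarios_def addresses_def)
qed

lemma scenario_event: "{\<omega> \<in> space M. scenario n \<omega> = s} \<in> sets choice_algebra"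
proof (cases "s \<in> extensional {..<n} \<times> extensional (addresses n)")
  case True
  then obtain \<kappa> c where s: "s = (\<kappa>, c)" "\<kappa> \<in> extensional {..<n}" "c \<in> extensional (addresses n)"
    by auto
  have "{\<omega> \<in> space M. scenario n \<omega> = s}
      = {\<omega> \<in> space choice_algebra. (\<forall>i\<in>{..<n}. K i \<omega> = \<kappa> i) \<and> (\<forall>v\<in>addresses n. C v \<omega> = c v)}"
    using s unfolding scenario_def space_algebras
    by (auto simp: restrict_def fun_eq_iff extensional_def)
  also have "\<dots> \<in> sets choice_algebra"
  proof (intro sets.sets_Collect_conj sets.sets_Collect_finite_All finite_addresses)
    show "{\<omega> \<in> space choice_algebra. K i \<omega> = \<kappa> i} \<in> sets choice_algebra" for i
      using measurable_sets[OF K_choice, of "{\<kappa> i}" i] by (simp add: vimage_def Int_def conj_commute)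
    show "{\<omega> \<in> space choice_algebra. C v \<omega> = c v} \<in> sets choice_algebra" for v
      using measurable_sets[OF C_choice, of "{c v}" v] by (simp add: vimage_def Int_def conj_commute)
  qed auto
  finally show ?thesis .
next
  case False
  then have "{\<omega> \<in> space M. scenario n \<omega> = s} = {}" by (auto simp: scenario_def)
  then show ?thesis by (simp only: sets.empty_sets)
qed

definition breaking_decay :: "real \<Rightarrow> nat \<Rightarrow> real" where
  "breaking_decay \<theta> k = (if k = 1 then 1 else (1 + (contraction \<theta>)\<^sup>2) / 2)"

text \<open>
  In a fixed scenario the cut points actually used are the independent variables \<open>X v (c v)\<close>, so the
  bound for frozen choices applies.  Measurability with respect to \<^const>\<open>cut_algebra\<close> is what
  makes this moment independent of the event that the scenario occurs.
\<close>
lemma scenario_second_moment: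
  assumes \<theta>: "\<theta> \<noteq> 0" and s: "(\<kappa>, c) \<in> scenarios n"
  defines "W \<equiv> \<lambda>\<omega>. (cmod (mean_phase \<kappa> (\<lambda>v. X v (c v) \<omega>) \<theta> n))\<^sup>2"
  shows "W \<in> borel_measurable cut_algebra"
    and "expectation W \<le> 2 / (1 - (contraction \<theta>)\<^sup>2) * (\<Prod>i<n. breaking_decay \<theta> (\<kappa> i))"
proof -
  have \<kappa>: "\<kappa> i \<in> set_pmf G" if "i < n" for i
    using s that by (auto simp: scenarios_def)
  have \<kappa>_range: "1 \<le> \<kappa> i" "\<kappa> i \<le> m" if "i < n" for i
    using \<kappa>[OF that] G_range by auto
  have sticks: "sticks \<kappa> i \<subseteq> addresses n" if "i < n" for i
  proof
    fix v assume v: "v \<in> sticks \<kappa> i"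
    have "set v \<subseteq> {..<m}"
      using that \<kappa>_range by (intro set_stick_subset[OF v]) auto
    then show "v \<in> addresses n"
      using that length_stick[OF v] by (simp add: addresses_def)
  qed
  have c: "c v \<in> F (\<kappa> (length v))" if "v \<in> addresses n" for v
    using s that by (auto simp: scenarios_def)
  have cI: "(v, c v) \<in> I" if "v \<in> addresses n" for v
    using c[OF that] \<kappa>[of "length v"] that by (auto simp: addresses_def)
  have c_stick: "c v \<in> F (\<kappa> i)" and good: "good_distribution (\<kappa> i - 1) (c v)"
    if "i < n" "v \<in> sticks \<kappa> i" for v i
  proof -
    show *: "c v \<in> F (\<kappa> i)"
      using c[of v] sticks[OF that(1)] length_stick[OF that(2)] that(2) by auto
    show "good_distribution (\<kappa> i - 1) (c v)"
      using \<kappa>_range[OF that(1)] by (intro F_good[OF _ *]) auto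
  qed
  interpret branching_phases M c "\<lambda>v. X v (c v)" "addresses n" \<kappa> n "gap_phase \<kappa> \<theta>" "contraction \<theta>"
  proof
    show "indep_vars c (\<lambda>v. X v (c v)) (addresses n)"
      using indep_vars_reindex[OF X_indep, of "\<lambda>v. (v, c v)" "addresses n"] cI
      by (auto intro: inj_onI)
  next
    fix i v j assume i: "i < n" and v: "v \<in> sticks \<kappa> i" and j: "j < \<kappa> i"
    have gap_meas: "(\<lambda>z. gap (\<kappa> i - 1) z j) \<in> borel_measurable (c v)"
      using good_distribution_gap(1)[OF good[OF i v] j] .
    then show y_meas: "gap_phase \<kappa> \<theta> v j \<in> borel_measurable (c v)"
      unfolding gap_phase_def[abs_def] length_stick[OF v] cis_conv_exp by measurable
    assume "\<kappa> i \<noteq> 1"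
    have I: "(v, c v) \<in> I" using cI sticks[OF i] v by auto
    have "expectation (\<lambda>\<omega>. gap_phase \<kappa> \<theta> v j (X v (c v) \<omega>))
        = (\<integral>z. gap_phase \<kappa> \<theta> v j z \<partial>distr M (c v) (X v (c v)))"
      using y_meas by (intro integral_distr[symmetric] X_measurable[OF I])
    also have "\<dots> = (\<integral>z. cis (\<theta> * ln (gap (\<kappa> i - 1) z j)) \<partial>c v)"
      unfolding X_distr[OF I] by (simp add: gap_phase_def length_stick[OF v])
    also have "cmod \<dots> \<le> contraction \<theta>"
      by (rule contraction(3)[OF \<theta> \<kappa>[OF i] \<open>\<kappa> i \<noteq> 1\<close> c_stick[OF i v] j])
    finally show "cmod (expectation (\<lambda>\<omega>. gap_phase \<kappa> \<theta> v j (X v (c v) \<omega>))) \<le> contraction \<theta>" .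
  next
    fix i v z assume "v \<in> sticks \<kappa> i" "\<kappa> i = 1"
    then show "gap_phase \<kappa> \<theta> v 0 z = 1"
      by (simp add: gap_phase_def length_stick gap_unbroken)
  qed (use sticks \<kappa>_range contraction(1,2)[OF \<theta>] in \<open>auto simp: gap_phase_def Suc_le_eq\<close>)
  have W: "W \<omega> = (cmod (\<Sum>v\<in>sticks \<kappa> n. 1 * phase v \<omega>))\<^sup>2 / (real (card (sticks \<kappa> n)))\<^sup>2" for \<omega>
    by (simp add: W_def mean_phase_def phase_def norm_divide power_divide)
  show "W \<in> borel_measurable cut_algebra"
  proof -
    have "(\<lambda>\<omega>. restrict (\<lambda>v. X v (c v) \<omega>) (past n)) \<in> measurable cut_algebra (PiM (past n) c)"
      using cI by (intro measurable_restrict X_cut) (auto simp: past_def)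
    from measurable_compose[OF this path_prod_measurable]
    have "phase v \<in> borel_measurable cut_algebra" if "v \<in> sticks \<kappa> n" for v
      using that phase_eq_past[OF that] by (simp cong: measurable_cong)
    then show ?thesis
      unfolding W[abs_def] by (intro borel_measurable_divide borel_measurable_power
          borel_measurable_norm borel_measurable_sum borel_measurable_times) auto
  qed
  have "0 < card (sticks \<kappa> n)"
    using sticks_nonempty[of n \<kappa>] finite_sticks \<kappa>_range by (force simp: card_gt_0_iff Suc_le_eq)
  moreover have "decay n = (\<Prod>i<n. breaking_decay \<theta> (\<kappa> i))"
    by (simp add: decay_def breaking_decay_def)
  ultimately show "expectation W \<le> 2 / (1 - (contraction \<theta>)\<^sup>2) * (\<Prod>i<n. breaking_decay \<theta> (\<kappa> i))"
    unfolding W using second_moment_phase_sum[of n "\<lambda>_. 1"]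
    by (simp add: pos_divide_le_eq)
qed

text \<open>
  The numbers \<open>K i\<close> being independent, averaging the decay over them gives the power of a single mean
  \<open>\<beta> = q + (1 - q) * pmf G 1\<close>, where \<open>q < 1\<close> is the decay of a breaking level; it is below 1 because
  \<open>pmf G 1 < 1\<close>.  This avoids any estimate of how often the sticks have been broken.
\<close>
lemma expectation_breaking_decay:
  assumes \<theta>: "\<theta> \<noteq> 0"
  obtains \<beta> where "0 \<le> \<beta>" "\<beta> < 1" "\<And>n. expectation (\<lambda>\<omega>. \<Prod>i<n. breaking_decay \<theta> (K i \<omega>)) = \<beta> ^ n"
proof
  define q where "q = (1 + (contraction \<theta>)\<^sup>2) / 2"
  have q: "0 < q" "q < 1"
    using contraction(1,2)[OF \<theta>] by (auto simp: q_def power_less_one_iff add_pos_nonneg)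
  define \<beta> where "\<beta> = q + (1 - q) * pmf G 1"
  show "0 \<le> \<beta>" using q by (simp add: \<beta>_def)
  have "(1 - q) * pmf G 1 < (1 - q) * 1"
    using q G_breaks by (intro mult_strict_left_mono) auto
  then show "\<beta> < 1" by (simp add: \<beta>_def)
  fix n
  have decay: "breaking_decay \<theta> k = q + (1 - q) * indicator {1} k" for k
    by (simp add: breaking_decay_def q_def field_simps)
  have one: "expectation (\<lambda>\<omega>. breaking_decay \<theta> (K i \<omega>)) = \<beta>" for i
  proof -
    have "expectation (\<lambda>\<omega>. breaking_decay \<theta> (K i \<omega>))
        = (\<integral>k. breaking_decay \<theta> k \<partial>distr M (count_space UNIV) (K i))"
      by (intro integral_distr[symmetric]) auto
    also have "\<dots> = \<beta>"
      unfolding K_distr decay \<beta>_def by (simp add: pmf.rep_eq measure_pmf.integrable_const_bound[of _ 1]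
          Bochner_Integration.integral_add del: integral_indicator)
    finally show ?thesis .
  qed
  have "expectation (\<lambda>\<omega>. \<Prod>i\<in>{..<n}. breaking_decay \<theta> (K i \<omega>))
      = (\<Prod>i\<in>{..<n}. expectation (\<lambda>\<omega>. breaking_decay \<theta> (K i \<omega>)))"
  proof (rule indep_vars_lebesgue_integral)
    show "indep_vars (\<lambda>_. borel) (\<lambda>i \<omega>. breaking_decay \<theta> (K i \<omega>)) {..<n}"
      by (rule indep_vars_compose2[OF indep_vars_subset[OF K_indep subset_UNIV]]) auto
    show "integrable M (\<lambda>\<omega>. breaking_decay \<theta> (K i \<omega>))" for i
      using q by (intro integrable_const_bound[where B = 1])
        (auto simp: decay indicator_def intro: measurable_compose[OF K_measurable])
  qed auto
  then show "expectation (\<lambda>\<omega>. \<Prod>i<n. breaking_decay \<theta> (K i \<omega>)) = \<beta> ^ n"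
    by (simp add: one)
qed

text \<open>
  Splitting according to the scenario, the second moment of the mean phase at level \<open>n\<close> is at most
  \<open>c * \<beta> ^ n\<close>.  These bounds are summable, hence the squares tend to 0 almost surely.
\<close>
proposition AE_mean_phase_tendsto_0:
  assumes \<theta>: "\<theta> \<noteq> 0"
  shows "AE \<omega> in M. (\<lambda>n. mean_phase (\<lambda>n. K n \<omega>) (\<lambda>v. X v (C v \<omega>) \<omega>) \<theta> n) \<longlonglongrightarrow> 0"
proof -
  define E where "E n s = {\<omega> \<in> space M. scenario n \<omega> = s}" for n s
  define W where "W n = (\<lambda>(\<kappa>, c) \<omega>. (cmod (mean_phase \<kappa> (\<lambda>v. X v (c v) \<omega>) \<theta> n))\<^sup>2)"
    for n :: nat
  \<comment> \<open>Almost surely equal to the squared mean phase, but visibly measurable.\<close>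
  define T where "T n \<omega> = (\<Sum>s\<in>scenarios n. indicator (E n s) \<omega> * W n s \<omega>)" for n \<omega>
  define c where "c = 2 / (1 - (contraction \<theta>)\<^sup>2)"
  have c: "0 \<le> c"
    using contraction(1,2)[OF \<theta>] by (simp add: c_def power_le_one)
  have E_choice: "E n s \<in> sets choice_algebra" for n s
    unfolding E_def by (rule scenario_event)
  have algebras: "sets choice_algebra \<subseteq> events" "sets cut_algebra \<subseteq> events"
    using choices_cuts_indep by (auto simp: indep_sets2_eq)
  then have E [measurable]: "E n s \<in> events" for n s
    using E_choice[of n s] by blast
  have cut_M: "f \<in> borel_measurable M" if "f \<in> borel_measurable cut_algebra" for f :: "'a \<Rightarrow> real"
    using that algebras(2) by (auto simp: measurable_def space_algebras)
  have W_cut: "W n s \<in> borel_measurable cut_algebra" if "s \<in> scenarios n" for n s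
    using scenario_second_moment(1)[OF \<theta>] that by (cases s) (auto simp: W_def)
  have W_bound: "0 \<le> W n s \<omega>" "W n s \<omega> \<le> 1" for n s \<omega>
    using norm_mean_phase_le_1 by (auto simp: W_def power_le_one split: prod.splits)
  have W_int: "integrable M (W n s)" if "s \<in> scenarios n" for n s
    using W_bound cut_M[OF W_cut[OF that]] by (intro integrable_const_bound[where B = 1]) auto
  have EW_int: "integrable M (\<lambda>\<omega>. indicator (E n s) \<omega> * W n s \<omega>)" if "s \<in> scenarios n" for n s
    using W_bound cut_M[OF W_cut[OF that]]
    by (intro integrable_const_bound[where B = 1]) (auto simp: indicator_def)
  have split: "AE \<omega> in M. \<forall>n. (\<Sum>s\<in>scenarios n. indicator (E n s) \<omega> * h n s \<omega>) = h n (scenario n \<omega>) \<omega>"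
    for h :: "nat \<Rightarrow> _ \<Rightarrow> 'a \<Rightarrow> real"
    using AE_scenario AE_space
  proof eventually_elim
    case (elim \<omega>)
    show ?case
    proof
      fix n
      have "(\<Sum>s\<in>scenarios n. indicator (E n s) \<omega> * h n s \<omega>)
          = (\<Sum>s\<in>scenarios n. if s = scenario n \<omega> then h n s \<omega> else 0)"
        using elim by (intro sum.cong) (auto simp: E_def)
      then show "(\<Sum>s\<in>scenarios n. indicator (E n s) \<omega> * h n s \<omega>) = h n (scenario n \<omega>) \<omega>"
        using elim finite_scenarios by simp
    qed
  qed
  have T_int: "integrable M (T n)" for n
    unfolding T_def[abs_def] by (intro Bochner_Integration.integrable_sum EW_int)
  have T_nonneg: "0 \<le> T n \<omega>" for n \<omega>
    unfolding T_def by (intro sum_nonneg mult_nonneg_nonneg W_bound) auto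
  have T_le: "expectation (T n) \<le> c * expectation (\<lambda>\<omega>. \<Prod>i<n. breaking_decay \<theta> (K i \<omega>))" for n
  proof -
    let ?d = "\<lambda>s. \<Prod>i<n. breaking_decay \<theta> (fst s i)"
    have "expectation (T n) = (\<Sum>s\<in>scenarios n. expectation (\<lambda>\<omega>. indicator (E n s) \<omega> * W n s \<omega>))"
      unfolding T_def by (intro Bochner_Integration.integral_sum EW_int)
    also have "\<dots> = (\<Sum>s\<in>scenarios n. prob (E n s) * expectation (W n s))"
      by (intro sum.cong refl expectation_indicator_times_indep[OF choices_cuts_indep]
          space_algebras E_choice W_cut W_int)
    also have "\<dots> \<le> (\<Sum>s\<in>scenarios n. prob (E n s) * (c * ?d s))"
    proof (intro sum_mono mult_left_mono measure_nonneg)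
      fix s assume "s \<in> scenarios n"
      then show "expectation (W n s) \<le> c * ?d s"
        using scenario_second_moment(2)[OF \<theta>, of "fst s" "snd s" n]
        by (simp add: W_def c_def case_prod_beta)
    qed
    also have "\<dots> = c * (\<Sum>s\<in>scenarios n. expectation (\<lambda>\<omega>. indicator (E n s) \<omega> * ?d s))"
      by (simp add: sum_distrib_left mult_ac)
    also have "(\<Sum>s\<in>scenarios n. expectation (\<lambda>\<omega>. indicator (E n s) \<omega> * ?d s))
        = expectation (\<lambda>\<omega>. \<Sum>s\<in>scenarios n. indicator (E n s) \<omega> * ?d s)"
      by (intro Bochner_Integration.integral_sum[symmetric] integrable_mult_left
          integrable_const_bound[where B = 1]) auto
    also have "\<dots> = expectation (\<lambda>\<omega>. \<Prod>i<n. breaking_decay \<theta> (K i \<omega>))"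
    proof (rule integral_cong_AE)
      show "AE \<omega> in M. (\<Sum>s\<in>scenarios n. indicator (E n s) \<omega> * ?d s) = (\<Prod>i<n. breaking_decay \<theta> (K i \<omega>))"
        using split[of "\<lambda>n s \<omega>. \<Prod>i<n. breaking_decay \<theta> (fst s i)"]
        by eventually_elim (simp add: scenario_def)
      show "(\<lambda>\<omega>. \<Prod>i<n. breaking_decay \<theta> (K i \<omega>)) \<in> borel_measurable M"
        by (intro borel_measurable_prod measurable_compose[OF K_measurable]) auto
    qed auto
    finally show ?thesis .
  qed
  obtain \<beta> where \<beta>: "0 \<le> \<beta>" "\<beta> < 1"
    "\<And>n. expectation (\<lambda>\<omega>. \<Prod>i<n. breaking_decay \<theta> (K i \<omega>)) = \<beta> ^ n"
    using expectation_breaking_decay[OF \<theta>] by blast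
  have "summable (\<lambda>n. expectation (T n))"
  proof (rule summable_comparison_test')
    show "summable (\<lambda>n. c * \<beta> ^ n)"
      using \<beta> by (intro summable_mult summable_geometric) auto
    show "norm (expectation (T n)) \<le> c * \<beta> ^ n" for n
      using T_le[of n] T_nonneg \<beta>(3) by (simp add: integral_nonneg)
  qed
  then have "AE \<omega> in M. (\<lambda>n. T n \<omega>) \<longlonglongrightarrow> 0"
    using T_int T_nonneg by (intro AE_tendsto_0_of_summable_expectations)
  with split[of W] AE_scenario show ?thesis
  proof eventually_elim
    case (elim \<omega>)
    let ?z = "\<lambda>n. mean_phase (\<lambda>n. K n \<omega>) (\<lambda>v. X v (C v \<omega>) \<omega>) \<theta> n"
    have "T n \<omega> = (cmod (?z n))\<^sup>2" for n
    proof -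
      have "K i \<omega> \<le> m" if "i < n" for i
        using elim(2) that G_range by (force simp: scenario_def scenarios_def)
      then have sticks: "u \<in> addresses n" if "k < n" "u \<in> sticks (\<lambda>n. K n \<omega>) k" for k u
        using that set_stick_subset[OF that(2), of m] length_stick[OF that(2)]
        by (auto simp: addresses_def)
      have "T n \<omega> = W n (scenario n \<omega>) \<omega>"
        using elim(1) by (simp add: T_def)
      also have "\<dots> = (cmod (?z n))\<^sup>2"
        unfolding W_def scenario_def prod.case
        by (intro arg_cong[of _ _ "\<lambda>z. (cmod z)\<^sup>2"] mean_phase_cong[symmetric]) (simp_all add: sticks)
      finally show ?thesis .
    qed
    with elim(3) have "(\<lambda>n. (cmod (?z n))\<^sup>2) \<longlonglongrightarrow> 0" by simp
    then have "(\<lambda>n. sqrt ((cmod (?z n))\<^sup>2)) \<longlonglongrightarrow> sqrt 0"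
      by (rule tendsto_real_sqrt)
    then show "?z \<longlonglongrightarrow> 0"
      by (simp add: tendsto_norm_zero_iff)
  qed
qed

end

theorem theorem1p5:
  fixes B L :: real and m :: nat and G :: "nat pmf"
    and F :: "nat \<Rightarrow> (nat \<Rightarrow> real) measure set"
    and M :: "'a measure"
    and K :: "nat \<Rightarrow> 'a \<Rightarrow> nat"
    and C :: "nat list \<Rightarrow> 'a \<Rightarrow> (nat \<Rightarrow> real) measure"
    and X :: "nat list \<Rightarrow> (nat \<Rightarrow> real) measure \<Rightarrow> 'a \<Rightarrow> nat \<Rightarrow> real"
  assumes "B > 1" and "L > 0"
    and "set_pmf G \<subseteq> {1..m}" and "pmf G 1 < 1"
    and "\<And>k. k \<in> {1..m} \<Longrightarrow> finite (F k)"
    and "\<And>k D. k \<in> {1..m} \<Longrightarrow> D \<in> F k \<Longrightarrow>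
           good_distribution (k - 1) D \<and> has_density_on_cube (k - 1) D"
    and "breaking_process M G F K C X"
  shows "AE \<omega> in M. strong_benford_limit B
           (\<lambda>N. stick_lengths (\<lambda>n. K n \<omega>) (\<lambda>v. X v (C v \<omega>) \<omega>) L N)"
proof -
  interpret stick_breaking m G F M K C X
    using assms by unfold_locales blast+
  define \<theta> where "\<theta> h = 2 * pi * of_int h / ln B" for h :: int
  have \<theta>: "\<theta> h \<noteq> 0" if "h \<noteq> 0" for h
    using \<open>B > 1\<close> that by (simp add: \<theta>_def)
  have "AE \<omega> in M. \<forall>h. h \<noteq> 0 \<longrightarrow>
      (\<lambda>n. mean_phase (\<lambda>n. K n \<omega>) (\<lambda>v. X v (C v \<omega>) \<omega>) (\<theta> h) n) \<longlonglongrightarrow> 0"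
    unfolding AE_all_countable using AE_mean_phase_tendsto_0[OF \<theta>] by auto
  with AE_K AE_stick_lengths[OF \<open>L > 0\<close>] show ?thesis
  proof eventually_elim
    case (elim \<omega>)
    let ?\<kappa> = "\<lambda>n. K n \<omega>" and ?x = "\<lambda>v. X v (C v \<omega>) \<omega>"
    show ?case
      unfolding stick_lengths_def
    proof (rule strong_benford_limitI[OF \<open>B > 1\<close> finite_sticks])
      show "sticks ?\<kappa> N \<noteq> {}" for N
        using elim(1) G_range by (intro sticks_nonempty) (auto simp: Suc_le_eq subset_iff)
      show "0 < stick_length ?\<kappa> ?x L v" if "v \<in> sticks ?\<kappa> N" for N v
        using elim(2) that by blast
      fix h :: int assume "h \<noteq> 0"
      have "(\<Sum>v\<in>sticks ?\<kappa> N. cis (\<theta> h * ln (stick_length ?\<kappa> ?x L v))) / of_nat (card (sticks ?\<kappa> N))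
          = cis (\<theta> h * ln L) * mean_phase ?\<kappa> ?x (\<theta> h) N" for N
        using elim(2) by (simp add: mean_phase_def sum_distrib_left)
      moreover have "(\<lambda>N. cis (\<theta> h * ln L) * mean_phase ?\<kappa> ?x (\<theta> h) N) \<longlonglongrightarrow> cis (\<theta> h * ln L) * 0"
        using elim(3) \<open>h \<noteq> 0\<close> by (intro tendsto_mult_left) auto
      ultimately show "(\<lambda>N. (\<Sum>v\<in>sticks ?\<kappa> N. cis (2 * pi * of_int h / ln B * ln (stick_length ?\<kappa> ?x L v)))
          / of_nat (card (sticks ?\<kappa> N))) \<longlonglongrightarrow> 0"
        by (simp add: \<theta>_def)
    qed
  qed
qed

end
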